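(* Let $\alpha,\beta$ be left-c.e. reals. For a left-c.e. real $\gamma$, let $\langle\gamma\rangle=\langle\gamma_s\rangle_{s\in\mathbb N}$ range over the nondecreasing computable sequences of non-negative rationals converging to $\gamma$ with $\gamma_s<\gamma$ for all $s$ (assume such sequences exist for $\alpha$ and $\beta$, i.e. $\alpha,\beta>0$). The following are equivalent. (i) $\beta\le_S\alpha$ (Solovay reducibility). (ii) For every $\langle\alpha\rangle$ there is $\langle\beta\rangle$ such that $\mathbf c_{\langle\alpha\rangle}\to\mathbf c_{\langle\beta\rangle}$. (iii) There are $\langle\alpha\rangle$ and $\langle\beta\rangle$ such that $\mathbf c_{\langle\alpha\rangle}\to\mathbf c_{\langle\beta\rangle}$.
   Context: Let $\mathbb Q_2$ denote the dyadic rationals. For left-c.e. reals, $\beta\le_S\alpha$ if there are a partial computable function $\phi:\mathbb Q_2\cap[0,\alpha)\to\mathbb Q_2\cap[0,\beta)$ (defined on all of $\mathbb Q_2\cap[0,\alpha)$) and $N\in\mathbb N$ such that for all $q\in\mathbb Q_2\cap[0,\alpha)$: $\beta-\phi(q)<N(\alpha-q)$. A cost function is a computable function $\mathbf c:\mathbb N\times\mathbb N\to\{q\in\mathbb Q: q\ge 0\}$. For a nondecreasing computable sequence $\langle\gamma\rangle=\langle\gamma_s\rangle$ of non-negative rationals converging to $\gamma$, the cost function $\mathbf c_{\langle\gamma\rangle}$ is given by $\mathbf c_{\langle\gamma\rangle}(x,s)=\gamma_s-\gamma_x$ for $x\le s$ and $\mathbf c_{\langle\gamma\rangle}(x,s)=0$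 for $x>s$. A computable approximation of a set $A\subseteq\mathbb N$ is a computable sequence of finite sets $\langle A_s\rangle_{s\in\mathbb N}$ such that $\lim_s A_s(x)=A(x)$ for each $x$. For $s>0$ let $\mathbf c_s(A_s)=\mathbf c(x,s)$, where $x<s$ and $x$ is least such that $A_{s-1}(x)\ne A_s(x)$; if there is no such $x$, let $\mathbf c_s(A_s)=0$. A $\Delta^0_2$ set $A$ obeys $\mathbf c$, written $A\models\mathbf c$, if some computable approximation of $A$ satisfies $\sum_{s>0}\mathbf c_s(A_s)<\infty$. We write $\mathbf c\to\mathbf d$ if for each $\Delta^0_2$ set $A$, $A\models\mathbf c$ implies $A\models\mathbf d$. *)

theory Defs
  imports Complex_Main "HOL-Library.Nat_Bijection"
begin

section \<open>Computability\<close>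

text \<open>
  Unbounded search: \<open>g 0, g 1, \<dots>\<close> are evaluated in turn until the value 0 is found;
  the search diverges if it meets an undefined value first, or if 0 never occurs.
\<close>

definition mu_search :: "(nat \<rightharpoonup> nat) \<rightharpoonup> nat" where
  "mu_search g =
     (if \<exists>n. g n = Some 0 \<and> (\<forall>m<n. g m \<noteq> None) then Some (LEAST n. g n = Some 0) else None)"

text \<open>
  The partial recursive functions of one argument. Functions of several arguments are
  represented by coding tuples with the Cantor pairing function \<^const>\<open>prod_encode\<close>, which
  is itself primitive recursive; with its two projections as initial functions and closure under
  pairing, these are the usual \<open>\<mu>\<close>-recursive functions.
\<close>

inductive partrec :: "(nat \<rightharpoonup> nat) \<Rightarrow> bool" where
  zero: "partrec (\<lambda>_. Some 0)"
| succ: "partrec (\<lambda>n. Some (Suc n))"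
| proj1: "partrec (\<lambda>n. Some (fst (prod_decode n)))"
| proj2: "partrec (\<lambda>n. Some (snd (prod_decode n)))"
| pair: "partrec f \<Longrightarrow> partrec g \<Longrightarrow>
    partrec (\<lambda>n. Option.bind (f n) (\<lambda>a. Option.bind (g n) (\<lambda>b. Some (prod_encode (a, b)))))"
| comp: "partrec f \<Longrightarrow> partrec g \<Longrightarrow> partrec (f \<circ>\<^sub>m g)"
| prec: "partrec f \<Longrightarrow> partrec g \<Longrightarrow>
    partrec (\<lambda>z. case prod_decode z of (a, n) \<Rightarrow>
      rec_nat (f a)
        (\<lambda>y r. Option.bind r (\<lambda>i. g (prod_encode (a, prod_encode (y, i))))) n)"
| mu: "partrec f \<Longrightarrow> partrec (\<lambda>a. mu_search (\<lambda>n. f (prod_encode (a, n))))"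

text \<open>
  Computability on other types is relative to injective codings of arguments and values by
  natural numbers. The behaviour of the witness on numbers that are not codes is irrelevant.
\<close>

definition partial_computable ::
  "('a \<Rightarrow> nat) \<Rightarrow> ('b \<Rightarrow> nat) \<Rightarrow> ('a \<rightharpoonup> 'b) \<Rightarrow> bool" where
  "partial_computable e d \<phi> \<longleftrightarrow>
     (\<exists>g. partrec g \<and> (\<forall>x. g (e x) = map_option d (\<phi> x)))"

definition computable :: "('a \<Rightarrow> nat) \<Rightarrow> ('b \<Rightarrow> nat) \<Rightarrow> ('a \<Rightarrow> 'b) \<Rightarrow> bool" where
  "computable e d f \<longleftrightarrow> partial_computable e d (\<lambda>x. Some (f x))"

definition rat_encode :: "rat \<Rightarrow> nat" where
  "rat_encode q = (case quotient_of q of (n, d) \<Rightarrow> prod_encode (int_encode n, nat d))"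

text \<open>The arithmetical hierarchy at level 2: \<open>A = {x. \<exists>y. \<forall>z. R x y z}\<close> with \<open>R\<close> decidable.\<close>

definition Sigma02 :: "nat set \<Rightarrow> bool" where
  "Sigma02 A \<longleftrightarrow>
     (\<exists>R :: nat \<times> nat \<times> nat \<Rightarrow> bool.
        computable (\<lambda>(x, y, z). prod_encode (x, prod_encode (y, z))) of_bool R \<and>
        (\<forall>x. x \<in> A \<longleftrightarrow> (\<exists>y. \<forall>z. R (x, y, z))))"

definition Delta02 :: "nat set \<Rightarrow> bool" where
  "Delta02 A \<longleftrightarrow> Sigma02 A \<and> Sigma02 (- A)"


section \<open>Left-c.e. reals and Solovay reducibility\<close>

definition left_ce :: "real \<Rightarrow> bool" where
  "left_ce \<gamma> \<longleftrightarrow>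
     (\<exists>q :: nat \<Rightarrow> rat. computable id rat_encode q \<and> incseq q \<and>
        (\<lambda>s. real_of_rat (q s)) \<longlonglongrightarrow> \<gamma>)"

text \<open>The sequences over which \<open>\<langle>\<gamma>\<rangle>\<close> ranges.\<close>

definition left_ce_approx :: "(nat \<Rightarrow> rat) \<Rightarrow> real \<Rightarrow> bool" where
  "left_ce_approx q \<gamma> \<longleftrightarrow>
     computable id rat_encode q \<and> incseq q \<and> (\<forall>s. 0 \<le> q s) \<and>
     (\<lambda>s. real_of_rat (q s)) \<longlonglongrightarrow> \<gamma> \<and> (\<forall>s. real_of_rat (q s) < \<gamma>)"

definition dyadic_rats :: "rat set" where
  "dyadic_rats = {of_int k / 2 ^ n | k n. True}"

definition dyadics_below :: "real \<Rightarrow> rat set" where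
  "dyadics_below \<alpha> = {q \<in> dyadic_rats. 0 \<le> q \<and> real_of_rat q < \<alpha>}"

definition solovay_le :: "real \<Rightarrow> real \<Rightarrow> bool" (infix "\<le>\<^sub>S" 50) where
  "\<beta> \<le>\<^sub>S \<alpha> \<longleftrightarrow>
     (\<exists>(\<phi> :: rat \<rightharpoonup> rat) (N :: nat).
        partial_computable rat_encode rat_encode \<phi> \<and>
        dom \<phi> = dyadics_below \<alpha> \<and> ran \<phi> \<subseteq> dyadics_below \<beta> \<and>
        (\<forall>q \<in> dyadics_below \<alpha>.
           \<beta> - real_of_rat (the (\<phi> q)) < real N * (\<alpha> - real_of_rat q)))"


section \<open>Cost functions\<close>

text \<open>
  The cost function \<open>c\<^bsub>\<langle>\<gamma>\<rangle>\<^esub>\<close>. It is computable and nonnegative whenever the sequence is computable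
  and nondecreasing, so the definitions below do not repeat these conditions on cost functions.
\<close>

definition seq_cost :: "(nat \<Rightarrow> rat) \<Rightarrow> nat \<Rightarrow> nat \<Rightarrow> rat" where
  "seq_cost q x s = (if x \<le> s then q s - q x else 0)"

lemma seq_cost_nonneg: "incseq q \<Longrightarrow> 0 \<le> seq_cost q x s"
  by (simp add: seq_cost_def incseqD)

definition computable_approx :: "(nat \<Rightarrow> nat set) \<Rightarrow> nat set \<Rightarrow> bool" where
  "computable_approx As A \<longleftrightarrow>
     (\<forall>s. finite (As s)) \<and> computable id set_encode As \<and>
     (\<forall>x. \<forall>\<^sub>F s in sequentially. x \<in> As s \<longleftrightarrow> x \<in> A)"

text \<open>The cost \<open>c\<^sub>s(A\<^sub>s)\<close> of the change at stage \<open>s\<close>; only used for \<open>s > 0\<close>.\<close>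

definition stage_cost :: "(nat \<Rightarrow> nat \<Rightarrow> rat) \<Rightarrow> (nat \<Rightarrow> nat set) \<Rightarrow> nat \<Rightarrow> rat" where
  "stage_cost c As s =
     (if \<exists>x<s. (x \<in> As (s - 1)) \<noteq> (x \<in> As s)
      then c (LEAST x. (x \<in> As (s - 1)) \<noteq> (x \<in> As s)) s else 0)"

text \<open>
  For a cost function \<open>c\<close> the stage costs are nonnegative, so summability says that the total cost
  is finite. The shift by \<^const>\<open>Suc\<close> makes the sum range over \<open>s > 0\<close>.
\<close>

definition obeys :: "nat set \<Rightarrow> (nat \<Rightarrow> nat \<Rightarrow> rat) \<Rightarrow> bool" (infix "\<Turnstile>\<^sub>c" 50) where
  "A \<Turnstile>\<^sub>c c \<longleftrightarrow>
     (\<exists>As. computable_approx As A \<and> summable (\<lambda>s. real_of_rat (stage_cost c As (Suc s))))"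

definition cost_implies ::
  "(nat \<Rightarrow> nat \<Rightarrow> rat) \<Rightarrow> (nat \<Rightarrow> nat \<Rightarrow> rat) \<Rightarrow> bool" (infix "\<rightarrow>\<^sub>c" 50) where
  "c \<rightarrow>\<^sub>c d \<longleftrightarrow> (\<forall>A. Delta02 A \<longrightarrow> A \<Turnstile>\<^sub>c c \<longrightarrow> A \<Turnstile>\<^sub>c d)"

end

theory Submission
  imports Defs
begin

text \<open>
  All three statements are equivalent to a bound \<open>\<beta> - b\<^sub>x \<le> N (\<alpha> - a\<^sub>x)\<close> for all \<open>x\<close>, for suitable
  approximations. Given the bound, an approximation obeying the cost function of \<open>a\<close> is sped up along
  stages \<open>\<sigma> i\<close> with \<open>b\<^bsub>i+1\<^esub> - b\<^sub>x < N (a\<^bsub>\<sigma> i\<^esub> - a\<^sub>x)\<close> for \<open>x \<le> i\<close>; each change of the faster one is then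
  paid for by a change of the original one. Solovay reducibility yields the bound by letting \<open>b\<^sub>s\<close> be
  the largest value of the reduction at dyadic rationals between \<open>a\<^bsub>0\<^esub>, \<dots>, a\<^bsub>s\<^esub>\<close> and \<open>\<alpha>\<close>, and
  conversely \<open>q\<close> is sent to a dyadic rational above \<open>b\<^sub>s\<close>, where \<open>q \<le> a\<^sub>s\<close>.

  If no bound exists, a finite injury argument builds a set obeying the cost function of \<open>a\<close> but not
  that of \<open>b\<close>. To make a computable approximation expensive, one switches membership of a number
  \<open>x\<close> on which the approximation currently agrees with the set, at a moment when the cost
  \<open>b\<^sub>t - b\<^sub>x\<close> of reacting exceeds a large multiple of one's own cost \<open>a\<^bsub>s+1\<^esub> - a\<^sub>x\<close>, and waits for the
  reaction. Such \<open>x\<close> exist beyond any given number because the bound fails, and taking the least one keeps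
  the gain of every switch away from 0, so that finitely many switches suffice.
\<close>

section \<open>Total recursive functions\<close>

abbreviation pfst :: "nat \<Rightarrow> nat" where "pfst n \<equiv> fst (prod_decode n)"
abbreviation psnd :: "nat \<Rightarrow> nat" where "psnd n \<equiv> snd (prod_decode n)"

definition total_rec :: "(nat \<Rightarrow> nat) \<Rightarrow> bool" where
  "total_rec f \<longleftrightarrow> partrec (\<lambda>n. Some (f n))"

definition rec_pred :: "(nat \<Rightarrow> bool) \<Rightarrow> bool" where
  "rec_pred P \<longleftrightarrow> total_rec (\<lambda>n. of_bool (P n))"

named_theorems rec_intros

lemma total_rec_compose: "total_rec f \<Longrightarrow> total_rec g \<Longrightarrow> total_rec (\<lambda>n. f (g n))"
  unfolding total_rec_def using partrec.comp[of "\<lambda>n. Some (f n)" "\<lambda>n. Some (g n)"]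
  by (simp add: map_comp_def)

lemma total_rec_pair [rec_intros]:
  "total_rec f \<Longrightarrow> total_rec g \<Longrightarrow> total_rec (\<lambda>n. prod_encode (f n, g n))"
  unfolding total_rec_def using partrec.pair[of "\<lambda>n. Some (f n)" "\<lambda>n. Some (g n)"] by simp

lemma total_rec_Suc [rec_intros]: "total_rec f \<Longrightarrow> total_rec (\<lambda>n. Suc (f n))"
  by (rule total_rec_compose[where f = Suc]) (auto simp: total_rec_def intro: partrec.intros)

lemma total_rec_pfst [rec_intros]: "total_rec f \<Longrightarrow> total_rec (\<lambda>n. pfst (f n))"
  by (rule total_rec_compose[where f = pfst]) (auto simp: total_rec_def intro: partrec.intros)

lemma total_rec_psnd [rec_intros]: "total_rec f \<Longrightarrow> total_rec (\<lambda>n. psnd (f n))"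
  by (rule total_rec_compose[where f = psnd]) (auto simp: total_rec_def intro: partrec.intros)

lemma total_rec_id [rec_intros]: "total_rec (\<lambda>n. n)"
proof -
  have "total_rec (\<lambda>n. prod_encode (pfst n, psnd n))"
    by (intro total_rec_pair) (auto simp: total_rec_def intro: partrec.intros)
  then show ?thesis by simp
qed

lemma total_rec_const [rec_intros]: "total_rec (\<lambda>_. c)"
proof (induction c)
  case 0
  show ?case by (auto simp: total_rec_def intro: partrec.intros)
next
  case (Suc c)
  then show ?case by (rule total_rec_Suc)
qed

text \<open>The step function takes the parameter as its first argument, so the recursion may depend
  on it. Its recursiveness is asked for on the coded triples that \<open>partrec.prec\<close> passes
  to it.\<close>

lemma total_rec_rec_nat [rec_intros]:
  assumes f: "total_rec f" and g: "total_rec (\<lambda>w. g (pfst w) (pfst (psnd w)) (psnd (psnd w)))"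
    and m: "total_rec m"
  shows "total_rec (\<lambda>n. rec_nat (f n) (g n) (m n))"
proof -
  have eq: "rec_nat (Some (f a)) (\<lambda>y r. Option.bind r (\<lambda>i. Some (g a y i))) n
      = Some (rec_nat (f a) (g a) n)" for a n
    by (induction n) auto
  have "total_rec (\<lambda>z. rec_nat (f (pfst z)) (g (pfst z)) (psnd z))"
    using partrec.prec[OF f[unfolded total_rec_def] g[unfolded total_rec_def]]
    by (simp add: total_rec_def eq case_prod_unfold)
  from total_rec_compose[OF this total_rec_pair[OF total_rec_id m]] show ?thesis by simp
qed

lemma partrec_Least:
  assumes P: "rec_pred (\<lambda>w. P (pfst w) (psnd w))"
  shows "partrec (\<lambda>n. if \<exists>k. P n k then Some (LEAST k. P n k) else None)"
proof -
  \<comment> \<open>\<open>mu_search\<close> looks for the value 0, so the truth value has to be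
    negated. Subtraction is not yet available, hence the primitive recursion.\<close>
  have "total_rec (\<lambda>n. rec_nat 1 (\<lambda>_ _. 0) (of_bool (P (pfst n) (psnd n))))"
    by (intro rec_intros P[unfolded rec_pred_def])
  moreover have "rec_nat 1 (\<lambda>_ _. 0) (of_bool c) = 1 - (of_bool c :: nat)" for c by (cases c) auto
  ultimately have "partrec (\<lambda>n. Some (1 - of_bool (P (pfst n) (psnd n)) :: nat))"
    by (simp add: total_rec_def)
  from partrec.mu[OF this]
  have "partrec (\<lambda>a. mu_search (\<lambda>n. Some (1 - of_bool (P a n))))" by simp
  moreover have "mu_search (\<lambda>n. Some (1 - of_bool (P a n)))
      = (if \<exists>k. P a k then Some (LEAST k. P a k) else None)" for a
    by (auto simp: mu_search_def intro!: arg_cong[where f = Least])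
  ultimately show ?thesis by simp
qed

lemma total_rec_Least [rec_intros]:
  assumes "rec_pred (\<lambda>w. P (pfst w) (psnd w))" and "\<And>n. \<exists>k. P n k"
  shows "total_rec (\<lambda>n. LEAST k. P n k)"
  using partrec_Least[OF assms(1)] by (simp add: total_rec_def assms(2))

section \<open>Arithmetic, decidable predicates and bounded quantifiers\<close>

lemma total_rec_add [rec_intros]:
  assumes "total_rec f" "total_rec g" shows "total_rec (\<lambda>n. f n + g n)"
proof -
  have "rec_nat a (\<lambda>_. Suc) b = a + b" for a b by (induction b) auto
  moreover have "total_rec (\<lambda>n. rec_nat (f n) (\<lambda>_. Suc) (g n))"
    by (intro rec_intros assms)
  ultimately show ?thesis by simp
qed

lemma total_rec_pred: assumes "total_rec f" shows "total_rec (\<lambda>n. f n - 1)"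
proof -
  have "rec_nat 0 (\<lambda>y _. y) b = b - 1" for b by (cases b) auto
  moreover have "total_rec (\<lambda>n. rec_nat 0 (\<lambda>y _. y) (f n))"
    by (intro rec_intros assms)
  ultimately show ?thesis by simp
qed

lemma total_rec_diff [rec_intros]:
  assumes "total_rec f" "total_rec g" shows "total_rec (\<lambda>n. f n - g n)"
proof -
  have "rec_nat a (\<lambda>_ r. r - 1) b = a - b" for a b :: nat by (induction b) auto
  moreover have "total_rec (\<lambda>n. rec_nat (f n) (\<lambda>_ r. r - 1) (g n))"
    by (intro rec_intros total_rec_pred assms)
  ultimately show ?thesis by simp
qed

lemma total_rec_mult [rec_intros]:
  assumes "total_rec f" "total_rec g" shows "total_rec (\<lambda>n. f n * g n)"
proof -
  have "rec_nat 0 (\<lambda>_ r. r + a) b = a * b" for a b :: nat by (induction b) auto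
  moreover have "total_rec (\<lambda>n. rec_nat 0 (\<lambda>_ r. r + f n) (g n))"
    by (rule total_rec_rec_nat) (intro rec_intros assms total_rec_compose[OF assms(1)])+
  ultimately show ?thesis by simp
qed

lemma total_rec_power [rec_intros]:
  assumes "total_rec f" "total_rec g" shows "total_rec (\<lambda>n. f n ^ g n)"
proof -
  have "rec_nat 1 (\<lambda>_ r. r * a) b = a ^ b" for a b :: nat by (induction b) auto
  moreover have "total_rec (\<lambda>n. rec_nat 1 (\<lambda>_ r. r * f n) (g n))"
    by (rule total_rec_rec_nat) (intro rec_intros assms total_rec_compose[OF assms(1)])+
  ultimately show ?thesis by simp
qed

lemma rec_pred_const [rec_intros]: "rec_pred (\<lambda>_. c)"
  unfolding rec_pred_def by (rule total_rec_const)

lemma rec_pred_not [rec_intros]: assumes "rec_pred P" shows "rec_pred (\<lambda>n. \<not> P n)"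
proof -
  have "total_rec (\<lambda>n. 1 - of_bool (P n))"
    using assms unfolding rec_pred_def by (intro rec_intros)
  moreover have "1 - of_bool (P n) = (of_bool (\<not> P n) :: nat)" for n by auto
  ultimately show ?thesis by (simp add: rec_pred_def)
qed

lemma rec_pred_conj [rec_intros]:
  assumes "rec_pred P" "rec_pred Q" shows "rec_pred (\<lambda>n. P n \<and> Q n)"
proof -
  have "total_rec (\<lambda>n. of_bool (P n) * of_bool (Q n))"
    using assms unfolding rec_pred_def by (intro rec_intros)
  then show ?thesis by (simp add: rec_pred_def of_bool_conj)
qed

lemma rec_pred_disj [rec_intros]:
  assumes "rec_pred P" "rec_pred Q" shows "rec_pred (\<lambda>n. P n \<or> Q n)"
proof -
  have "rec_pred (\<lambda>n. \<not> (\<not> P n \<and> \<not> Q n))" by (intro rec_intros assms)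
  then show ?thesis by simp
qed

lemma rec_pred_imp [rec_intros]:
  assumes "rec_pred P" "rec_pred Q" shows "rec_pred (\<lambda>n. P n \<longrightarrow> Q n)"
proof -
  have "rec_pred (\<lambda>n. \<not> P n \<or> Q n)" by (intro rec_intros assms)
  then show ?thesis by simp
qed

lemma rec_pred_le [rec_intros]:
  assumes "total_rec f" "total_rec g" shows "rec_pred (\<lambda>n. f n \<le> g n)"
proof -
  have "total_rec (\<lambda>n. 1 - (f n - g n))" by (intro rec_intros assms)
  moreover have "1 - (f n - g n) = of_bool (f n \<le> g n)" for n by auto
  ultimately show ?thesis by (simp add: rec_pred_def)
qed

lemma rec_pred_less [rec_intros]:
  assumes "total_rec f" "total_rec g" shows "rec_pred (\<lambda>n. f n < g n)"
proof -
  have "rec_pred (\<lambda>n. \<not> g n \<le> f n)" by (intro rec_intros assms)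
  then show ?thesis by (simp add: not_le)
qed

lemma rec_pred_eq [rec_intros]:
  assumes "total_rec f" "total_rec g" shows "rec_pred (\<lambda>n. f n = g n)"
proof -
  have "rec_pred (\<lambda>n. f n \<le> g n \<and> g n \<le> f n)" by (intro rec_intros assms)
  then show ?thesis by (simp add: order_eq_iff)
qed

lemma rec_pred_iff [rec_intros]:
  assumes "rec_pred P" "rec_pred Q" shows "rec_pred (\<lambda>n. P n \<longleftrightarrow> Q n)"
proof -
  have "rec_pred (\<lambda>n. (P n \<longrightarrow> Q n) \<and> (Q n \<longrightarrow> P n))" by (intro rec_intros assms)
  then show ?thesis by (simp add: iff_conv_conj_imp)
qed

lemma total_rec_of_bool [rec_intros]: "rec_pred P \<Longrightarrow> total_rec (\<lambda>n. of_bool (P n))"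
  by (simp add: rec_pred_def)

lemma total_rec_If [rec_intros]:
  assumes "rec_pred P" "total_rec f" "total_rec g"
  shows "total_rec (\<lambda>n. if P n then f n else g n)"
proof -
  have "total_rec (\<lambda>n. of_bool (P n) * f n + (1 - of_bool (P n)) * g n)" by (intro rec_intros assms)
  moreover have "of_bool (P n) * f n + (1 - of_bool (P n)) * g n = (if P n then f n else g n)" for n
    by auto
  ultimately show ?thesis by simp
qed

lemma total_rec_max [rec_intros]:
  "total_rec f \<Longrightarrow> total_rec g \<Longrightarrow> total_rec (\<lambda>n. max (f n) (g n))"
  unfolding max_def by (intro rec_intros)

lemma total_rec_div [rec_intros]:
  assumes "total_rec f" "total_rec g" shows "total_rec (\<lambda>n. f n div g n)"
proof -
  \<comment> \<open>The disjunct \<open>b = 0\<close> makes the search stop at 0, which is the value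
    of \<open>a div 0\<close>.\<close>
  have "a div b = (LEAST q. b = 0 \<or> a < Suc q * b)" for a b :: nat
  proof (cases "b = 0")
    case False
    show ?thesis
    proof (rule Least_equality[symmetric])
      show "b = 0 \<or> a < Suc (a div b) * b"
        using False by (simp add: dividend_less_div_times)
    next
      fix q assume "b = 0 \<or> a < Suc q * b"
      then have "a < Suc q * b" using False by simp
      then have "a div b < Suc q" by (rule less_mult_imp_div_less)
      then show "a div b \<le> q" by simp
    qed
  qed (simp add: Least_eq_0)
  moreover have "total_rec (\<lambda>n. LEAST q. g n = 0 \<or> f n < Suc q * g n)"
  proof (rule total_rec_Least)
    show "rec_pred (\<lambda>w. g (pfst w) = 0 \<or> f (pfst w) < Suc (psnd w) * g (pfst w))"
      by (intro rec_intros total_rec_compose[OF assms(1)] total_rec_compose[OF assms(2)])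
    show "\<exists>q. g n = 0 \<or> f n < Suc q * g n" for n
      by (cases "g n") (auto intro!: exI[of _ "f n"])
  qed
  ultimately show ?thesis by simp
qed

lemma total_rec_mod [rec_intros]:
  assumes "total_rec f" "total_rec g" shows "total_rec (\<lambda>n. f n mod g n)"
proof -
  have "total_rec (\<lambda>n. f n - f n div g n * g n)" by (intro rec_intros assms)
  then show ?thesis by (simp add: minus_div_mult_eq_mod)
qed

lemma rec_pred_dvd [rec_intros]:
  "total_rec f \<Longrightarrow> total_rec g \<Longrightarrow> rec_pred (\<lambda>n. f n dvd g n)"
  unfolding dvd_eq_mod_eq_0 by (intro rec_intros)

lemma total_rec_sum [rec_intros]:
  assumes f: "total_rec (\<lambda>w. f (pfst w) (psnd w))" and m: "total_rec m"
  shows "total_rec (\<lambda>n. \<Sum>u<m n. f n u)"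
proof -
  have "(\<Sum>u<k. f n u) = rec_nat 0 (\<lambda>y r. r + f n y) k" for n k
    by (induction k) auto
  moreover have "total_rec (\<lambda>w. f (pfst w) (pfst (psnd w)))"
    using total_rec_compose[OF f, of "\<lambda>w. prod_encode (pfst w, pfst (psnd w))"] 
    by (simp add: rec_intros)
  then have "total_rec (\<lambda>n. rec_nat 0 (\<lambda>y r. r + f n y) (m n))"
    by (intro rec_intros m)
  ultimately show ?thesis by simp
qed

text \<open>The number of counterexamples below the bound is a recursive sum, and it is tested for
  being 0.\<close>

lemma rec_pred_all_less [rec_intros]:
  assumes P: "rec_pred (\<lambda>w. P (pfst w) (psnd w))" and m: "total_rec m"
  shows "rec_pred (\<lambda>n. \<forall>u<m n. P n u)"
proof -
  have "rec_pred (\<lambda>n. (\<Sum>u<m n. of_bool (\<not> P n u)) = (0::nat))"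
    by (intro rec_intros P m)
  then show ?thesis by (simp add: disjoint_iff)
qed

lemma computableI: "total_rec g \<Longrightarrow> (\<And>x. g (e x) = d (f x)) \<Longrightarrow> computable e d f"
  by (auto simp: computable_def partial_computable_def total_rec_def)

lemma computable_id_iff: "computable id d f \<longleftrightarrow> total_rec (\<lambda>n. d (f n))"
proof
  assume "computable id d f"
  then obtain g where g: "partrec g" "\<And>x. g x = Some (d (f x))"
    by (auto simp: computable_def partial_computable_def)
  then have "g = (\<lambda>x. Some (d (f x)))" by auto
  with g(1) show "total_rec (\<lambda>n. d (f n))" by (simp add: total_rec_def)
qed (auto simp: computable_def partial_computable_def total_rec_def)

section \<open>Recursive sequences of rationals\<close>

definition rec_rat :: "(nat \<Rightarrow> rat) \<Rightarrow> bool" where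
  "rec_rat f \<longleftrightarrow> total_rec (\<lambda>n. rat_encode (f n))"

text \<open>Lowest terms without a gcd: the reduced denominator is the least positive
  \<open>k\<close> for which \<open>d\<close> divides \<open>n * k\<close>, so a search finds it.
  Here \<open>n\<close> is the absolute value of the numerator, and the sign is treated apart; by
  the second claim a negative numerator does not reduce to 0.\<close>

lemma quotient_of_fraction:
  fixes p m d :: nat
  defines "q \<equiv> (of_nat p - of_nat m) / of_nat d :: rat"
  assumes d: "d > 0"
  defines "n \<equiv> (p - m) + (m - p)"
  defines "k \<equiv> LEAST k. 0 < k \<and> d dvd n * k"
  shows "quotient_of q = (if m \<le> p then int (n * k div d) else - int (n * k div d), int k)"
    and "m \<le> p \<or> n * k div d > 0"
proof -
  obtain r j where rj: "quotient_of q = (r, j)" by fastforce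
  then have j: "j > 0" and cop: "coprime r j" and q: "q = of_int r / of_int j"
    using quotient_of_denom_pos quotient_of_coprime quotient_of_div by auto
  define j' where "j' = nat j"
  have jj: "j = int j'" "j' > 0" using j by (auto simp: j'_def)
  have "(of_nat p - of_nat m) * of_int j = (of_int r * of_nat d :: rat)"
    using q d j by (simp add: q_def field_simps)
  then have e: "(int p - int m) * j = r * int d"
    by (simp flip: of_int_eq_iff[where 'a = rat])
  have n: "int n = \<bar>int p - int m\<bar>" by (auto simp: n_def)
  have "int n * j = \<bar>r\<bar> * int d"
    using arg_cong[OF e, of abs] j by (simp add: n abs_mult)
  then have e': "n * j' = nat \<bar>r\<bar> * d"
    by (simp add: jj flip: of_nat_eq_iff[where 'a = int])
  have k: "k = j'"
    unfolding k_def
  proof (rule Least_equality)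
    show "0 < j' \<and> d dvd n * j'" using jj e' by simp
  next
    fix i assume i: "0 < i \<and> d dvd n * i"
    then obtain w where w: "n * i = d * w" by (auto simp: dvd_def)
    have "nat \<bar>r\<bar> * i * d = w * j' * d"
      using e' w by (metis mult.assoc mult.commute)
    then have "nat \<bar>r\<bar> * i = w * j'" using d by simp
    then have "j' dvd nat \<bar>r\<bar> * i" by simp
    moreover have "coprime j' (nat \<bar>r\<bar>)"
      using cop by (simp add: jj coprime_commute flip: coprime_int_iff)
    ultimately have "j' dvd i" by (simp add: coprime_dvd_mult_right_iff)
    then show "j' \<le> i" using i by (simp add: dvd_imp_le)
  qed
  have w: "n * k div d = nat \<bar>r\<bar>" using e' d k by simp
  have sgn: "0 \<le> r \<longleftrightarrow> m \<le> p"
  proof -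
    have "0 \<le> r \<longleftrightarrow> 0 \<le> r * int d" using d by (simp add: zero_le_mult_iff)
    also have "\<dots> \<longleftrightarrow> 0 \<le> (int p - int m) * j" by (simp add: e)
    also have "\<dots> \<longleftrightarrow> m \<le> p" using j by (auto simp add: zero_le_mult_iff)
    finally show ?thesis .
  qed
  show "quotient_of q = (if m \<le> p then int (n * k div d) else - int (n * k div d), int k)"
    using sgn unfolding rj w by (auto simp: k jj(1))
  show "m \<le> p \<or> n * k div d > 0" using sgn by (auto simp: w)
qed

text \<open>Codes hold reduced fractions, whereas arithmetic is easiest on arbitrary fractions whose
  numerator is a difference of naturals. The reduction is done here once for all closure properties;
  \<open>rec_rat_fractionE\<close> leads back.\<close>

lemma rec_rat_fractionI:
  assumes p: "total_rec p" and m: "total_rec m" and d: "total_rec d" and pos: "\<And>n. d n > 0"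
    and f: "\<And>n. f n = (of_nat (p n) - of_nat (m n)) / of_nat (d n)"
  shows "rec_rat f"
proof -
  define v where "v n = (p n - m n) + (m n - p n)" for n
  define k where "k n = (LEAST k. 0 < k \<and> d n dvd v n * k)" for n
  define w where "w n = v n * k n div d n" for n
  have v: "total_rec v" unfolding v_def by (intro rec_intros p m)
  \<comment> \<open>The search for \<open>k n\<close> succeeds because \<open>d n\<close> itself
    qualifies.\<close>
  have k: "total_rec k"
    unfolding k_def
    by (intro rec_intros total_rec_compose[OF v] total_rec_compose[OF d])
      (use pos in \<open>auto intro: dvd_triv_right\<close>)
  have w: "total_rec w" unfolding w_def by (intro rec_intros v k d)
  \<comment> \<open>\<open>int_encode\<close> sends a natural number \<open>w\<close> to
    \<open>2 * w\<close>, and \<open>- w\<close> with \<open>w > 0\<close> to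
    \<open>2 * w - 1\<close>.\<close>
  have "rat_encode (f n) = prod_encode (if m n \<le> p n then 2 * w n else 2 * w n - 1, k n)" for n
    using quotient_of_fraction[OF pos[of n], of "p n" "m n"]
    by (auto simp: rat_encode_def f v_def k_def w_def int_encode_def sum_encode_def nat_diff_distrib)
  moreover have "total_rec (\<lambda>n. prod_encode (if m n \<le> p n then 2 * w n else 2 * w n - 1, k n))"
    by (intro rec_intros p m w k)
  ultimately show ?thesis by (simp add: rec_rat_def)
qed

lemma rec_rat_fractionE:
  assumes "rec_rat f"
  obtains p m d where "total_rec p" "total_rec m" "total_rec d" "\<And>n. d n > 0"
    "\<And>n. f n = (of_nat (p n) - of_nat (m n)) / of_nat (d n)"
    "\<And>n. int (d n) = snd (quotient_of (f n))"
proof -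
  define c where "c n = pfst (rat_encode (f n))" for n
  have c: "total_rec c" unfolding c_def by (intro rec_intros assms[unfolded rec_rat_def])
  define p where "p n = (if 2 dvd c n then c n div 2 else 0)" for n
  define m where "m n = (if 2 dvd c n then 0 else Suc (c n div 2))" for n
  define d where "d n = psnd (rat_encode (f n))" for n
  have "total_rec p" "total_rec m" "total_rec d"
    unfolding p_def m_def d_def by (intro rec_intros c assms[unfolded rec_rat_def])+
  moreover have "d n > 0 \<and> f n = (of_nat (p n) - of_nat (m n)) / of_nat (d n)
      \<and> int (d n) = snd (quotient_of (f n))" for n
  proof -
    obtain r j where rj: "quotient_of (f n) = (r, j)" by fastforce
    then have j: "j > 0" and q: "f n = of_int r / of_int j"
      using quotient_of_denom_pos quotient_of_div by auto
    have d: "d n = nat j" by (simp add: d_def rat_encode_def rj)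
    have c: "c n = int_encode r" by (simp add: c_def rat_encode_def rj)
    have "int (p n) - int (m n) = r"
      by (auto simp: p_def m_def c int_encode_def sum_encode_def)
    then have "of_nat (p n) - of_nat (m n) = (of_int r :: rat)"
      by (metis of_int_diff of_int_of_nat_eq)
    then show ?thesis using d j q rj by simp
  qed
  ultimately show ?thesis using that by blast
qed

section \<open>Closure of recursive rational sequences under arithmetic and comparison\<close>

lemma rec_rat_add [rec_intros]:
  assumes "rec_rat f" "rec_rat g" shows "rec_rat (\<lambda>n. f n + g n)"
proof -
  obtain p m d where 1: "total_rec p" "total_rec m" "total_rec d" "\<And>n. d n > 0"
    "\<And>n. f n = (of_nat (p n) - of_nat (m n)) / of_nat (d n)"
    using rec_rat_fractionE[OF assms(1)] by metis
  obtain p' m' d' where 2: "total_rec p'" "total_rec m'" "total_rec d'" "\<And>n. d' n > 0"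
    "\<And>n. g n = (of_nat (p' n) - of_nat (m' n)) / of_nat (d' n)"
    using rec_rat_fractionE[OF assms(2)] by metis
  have nz: "of_nat (d n) \<noteq> (0::rat)" "of_nat (d' n) \<noteq> (0::rat)" for n
    using 1(4)[of n] 2(4)[of n] by auto
  show ?thesis
  proof (rule rec_rat_fractionI)
    show "total_rec (\<lambda>n. p n * d' n + p' n * d n)" "total_rec (\<lambda>n. m n * d' n + m' n * d n)"
      "total_rec (\<lambda>n. d n * d' n)" by (intro rec_intros 1 2)+
    show "d n * d' n > 0" for n using 1(4)[of n] 2(4)[of n] by simp
    show "f n + g n = (of_nat (p n * d' n + p' n * d n) - of_nat (m n * d' n + m' n * d n))
      / of_nat (d n * d' n)" for n
      using nz[of n] by (simp add: 1(5) 2(5) field_simps)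
  qed
qed

lemma rec_rat_uminus [rec_intros]:
  assumes "rec_rat f" shows "rec_rat (\<lambda>n. - f n)"
proof -
  obtain p m d where 1: "total_rec p" "total_rec m" "total_rec d" "\<And>n. d n > 0"
    "\<And>n. f n = (of_nat (p n) - of_nat (m n)) / of_nat (d n)"
    using rec_rat_fractionE[OF assms(1)] by metis
  show ?thesis
    by (rule rec_rat_fractionI[of m p d]) (use 1 in \<open>auto simp: minus_divide_left\<close>)
qed

lemma rec_rat_diff [rec_intros]:
  "rec_rat f \<Longrightarrow> rec_rat g \<Longrightarrow> rec_rat (\<lambda>n. f n - g n)"
  using rec_rat_add[OF _ rec_rat_uminus] by simp

lemma rec_rat_mult [rec_intros]:
  assumes "rec_rat f" "rec_rat g" shows "rec_rat (\<lambda>n. f n * g n)"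
proof -
  obtain p m d where 1: "total_rec p" "total_rec m" "total_rec d" "\<And>n. d n > 0"
    "\<And>n. f n = (of_nat (p n) - of_nat (m n)) / of_nat (d n)"
    using rec_rat_fractionE[OF assms(1)] by metis
  obtain p' m' d' where 2: "total_rec p'" "total_rec m'" "total_rec d'" "\<And>n. d' n > 0"
    "\<And>n. g n = (of_nat (p' n) - of_nat (m' n)) / of_nat (d' n)"
    using rec_rat_fractionE[OF assms(2)] by metis
  have nz: "of_nat (d n) \<noteq> (0::rat)" "of_nat (d' n) \<noteq> (0::rat)" for n
    using 1(4)[of n] 2(4)[of n] by auto
  show ?thesis
  proof (rule rec_rat_fractionI)
    show "total_rec (\<lambda>n. p n * p' n + m n * m' n)" "total_rec (\<lambda>n. m n * p' n + p n * m' n)"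
      "total_rec (\<lambda>n. d n * d' n)" by (intro rec_intros 1 2)+
    show "d n * d' n > 0" for n using 1(4)[of n] 2(4)[of n] by simp
    show "f n * g n = (of_nat (p n * p' n + m n * m' n) - of_nat (m n * p' n + p n * m' n))
      / of_nat (d n * d' n)" for n
      using nz[of n] by (simp add: 1(5) 2(5) field_simps)
  qed
qed

lemma rec_rat_of_nat [rec_intros]: "total_rec f \<Longrightarrow> rec_rat (\<lambda>n. of_nat (f n))"
  by (rule rec_rat_fractionI[of f "\<lambda>_. 0" "\<lambda>_. 1"]) (auto intro: rec_intros)

lemma rec_rat_of_nat_divide [rec_intros]:
  assumes "total_rec f" "total_rec g" "\<And>n. g n > 0"
  shows "rec_rat (\<lambda>n. of_nat (f n) / of_nat (g n))"
  by (rule rec_rat_fractionI[of f "\<lambda>_. 0" g]) (auto intro: rec_intros assms)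

lemma rec_rat_const [rec_intros]: "rec_rat (\<lambda>_. c)"
  unfolding rec_rat_def by (rule total_rec_const)

lemma rec_rat_compose: "rec_rat f \<Longrightarrow> total_rec g \<Longrightarrow> rec_rat (\<lambda>n. f (g n))"
  unfolding rec_rat_def by (rule total_rec_compose)

lemma rec_pred_rat_le [rec_intros]:
  assumes "rec_rat f" "rec_rat g" shows "rec_pred (\<lambda>n. f n \<le> g n)"
proof -
  obtain p m d where 1: "total_rec p" "total_rec m" "total_rec d" "\<And>n. d n > 0"
    "\<And>n. f n - g n = (of_nat (p n) - of_nat (m n)) / of_nat (d n)"
    using rec_rat_fractionE[OF rec_rat_diff[OF assms]] by metis
  have "f n \<le> g n \<longleftrightarrow> p n \<le> m n" for n
  proof -
    have "f n \<le> g n \<longleftrightarrow> f n - g n \<le> 0" by simp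
    also have "\<dots> \<longleftrightarrow> p n \<le> m n"
      using 1(4)[of n] by (simp add: 1(5) divide_le_0_iff)
    finally show ?thesis .
  qed
  moreover have "rec_pred (\<lambda>n. p n \<le> m n)" by (intro rec_intros 1)
  ultimately show ?thesis by simp
qed

lemma rec_pred_rat_less [rec_intros]:
  assumes "rec_rat f" "rec_rat g" shows "rec_pred (\<lambda>n. f n < g n)"
proof -
  have "rec_pred (\<lambda>n. \<not> g n \<le> f n)" by (intro rec_intros assms)
  then show ?thesis by (simp add: not_le)
qed

lemma rec_rat_If [rec_intros]:
  assumes "rec_pred P" "rec_rat f" "rec_rat g"
  shows "rec_rat (\<lambda>n. if P n then f n else g n)"
proof -
  have "total_rec (\<lambda>n. if P n then rat_encode (f n) else rat_encode (g n))"
    by (intro rec_intros assms assms(2,3)[unfolded rec_rat_def])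
  then show ?thesis by (simp add: rec_rat_def if_distrib)
qed

lemma rec_rat_max [rec_intros]:
  "rec_rat f \<Longrightarrow> rec_rat g \<Longrightarrow> rec_rat (\<lambda>n. max (f n) (g n))"
  unfolding max_def by (intro rec_intros)

text \<open>The maximum with 1 makes decoding computable on numbers that are not codes, too.\<close>

definition rat_decode :: "nat \<Rightarrow> rat" where
  "rat_decode n = Fract (int_decode (pfst n)) (int (max 1 (psnd n)))"

lemma rat_decode_encode [simp]: "rat_decode (rat_encode q) = q"
proof -
  obtain r j where rj: "quotient_of q = (r, j)" by fastforce
  then have j: "j > 0" "Fract r j = q"
    using quotient_of_denom_pos quotient_of_div by (auto simp: Fract_of_int_quotient)
  then have "int (max 1 (nat j)) = j" by simp
  with j show ?thesis by (simp add: rat_decode_def rat_encode_def rj del: quotient_of_Fract)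
qed

lemma rec_rat_decode [rec_intros]:
  assumes f: "total_rec f"
  shows "rec_rat (\<lambda>n. rat_decode (f n))"
proof -
  have e: "int_decode c = int (if 2 dvd c then c div 2 else 0) - int (if 2 dvd c then 0 else Suc (c div 2))"
    for c by (auto simp: int_decode_def sum_decode_def)
  show ?thesis
    by (rule rec_rat_fractionI[where
        p = "\<lambda>n. if 2 dvd pfst (f n) then pfst (f n) div 2 else 0" and
        m = "\<lambda>n. if 2 dvd pfst (f n) then 0 else Suc (pfst (f n) div 2)" and
        d = "\<lambda>n. max 1 (psnd (f n))"])
      (auto intro!: rec_intros f simp: rat_decode_def Fract_of_int_quotient e)
qed

lemma rec_rat_sum [rec_intros]:
  assumes f: "rec_rat (\<lambda>w. f (pfst w) (psnd w))" and m: "total_rec m"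
  shows "rec_rat (\<lambda>n. \<Sum>u<m n. f n u)"
proof -
  \<comment> \<open>Primitive recursion carries natural numbers, so the partial sums are passed on
    as codes.\<close>
  have "(\<Sum>u<k. f n u) = rat_decode (rec_nat (rat_encode 0) (\<lambda>y r. rat_encode (rat_decode r + f n y)) k)"
    for n k by (induction k) auto
  moreover have "rec_rat (\<lambda>w. f (pfst w) (pfst (psnd w)))"
    using rec_rat_compose[OF f, of "\<lambda>w. prod_encode (pfst w, pfst (psnd w))"]
    by (simp add: rec_intros)
  then have "rec_rat (\<lambda>n. rat_decode
      (rec_nat (rat_encode 0) (\<lambda>y r. rat_encode (rat_decode r + f n y)) (m n)))"
    by (intro rec_intros m) (unfold rec_rat_def[symmetric], intro rec_intros)
  ultimately show ?thesis by simp
qed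

section \<open>A universal machine\<close>

abbreviation triple :: "nat \<Rightarrow> nat \<Rightarrow> nat \<Rightarrow> nat" where
  "triple x y z \<equiv> prod_encode (x, prod_encode (y, z))"

text \<open>
  A stack machine: a state is either \<open>eval_state p x k\<close> (run program \<open>p\<close> on input \<open>x\<close>, then
  continue with the stack \<open>k\<close>) or \<open>return_state y k\<close> (pass the value \<open>y\<close> to the stack \<open>k\<close>).
  A stack is 0 or \<open>push\<close> of a frame, and a program is a triple of an instruction number,
  one for each clause of \<^const>\<open>partrec\<close>, and two subprograms.
\<close>

definition eval_state :: "nat \<Rightarrow> nat \<Rightarrow> nat \<Rightarrow> nat" where
  "eval_state p x k = prod_encode (0, triple p x k)"

definition return_state :: "nat \<Rightarrow> nat \<Rightarrow> nat" where
  "return_state y k = prod_encode (1, prod_encode (y, k))"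

definition push :: "nat \<Rightarrow> nat \<Rightarrow> nat \<Rightarrow> nat" where
  "push tag w k = Suc (triple tag w k)"

definition eval_step :: "nat \<Rightarrow> nat \<Rightarrow> nat \<Rightarrow> nat" where
  "eval_step p x k =
     (let tag = pfst p; p1 = pfst (psnd p); p2 = psnd (psnd p) in
      if tag = 0 then return_state 0 k
      else if tag = 1 then return_state (Suc x) k
      else if tag = 2 then return_state (pfst x) k
      else if tag = 3 then return_state (psnd x) k
      else if tag = 4 then eval_state p1 x (push 0 (prod_encode (p2, x)) k)
      else if tag = 5 then eval_state p2 x (push 2 p1 k)
      else if tag = 6 then eval_state p1 (pfst x)
        (push 3 (prod_encode (p2, triple (pfst x) 0 (psnd x))) k)
      else eval_state p1 (prod_encode (x, 0)) (push 4 (triple p1 x 0) k))"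

text \<open>Frames by tag: 0 and 1 wait for the first and second component of a pair, 2 for the
  inner value of a composition, 3 for the value at counter \<open>y\<close> of a primitive recursion
  up to \<open>n\<close>, 4 for the value at candidate \<open>n\<close> of a search.
  \<open>k - 1\<close> undoes the successor in \<open>push\<close>; on the empty stack the state is
  kept, which is how the machine halts.\<close>

definition return_step :: "nat \<Rightarrow> nat \<Rightarrow> nat" where
  "return_step v k =
     (let tag = pfst (k - 1); w = pfst (psnd (k - 1)); k' = psnd (psnd (k - 1)) in
      if k = 0 then return_state v k
      else if tag = 0 then eval_state (pfst w) (psnd w) (push 1 v k')
      else if tag = 1 then return_state (prod_encode (w, v)) k'
      else if tag = 2 then eval_state w v k'
      else if tag = 3 then
        (let p2 = pfst w; a = pfst (psnd w); y = pfst (psnd (psnd w)); n = psnd (psnd (psnd w)) in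
         if y = n then return_state v k'
         else eval_state p2 (triple a y v) (push 3 (prod_encode (p2, triple a (Suc y) n)) k'))
      else
        (let p1 = pfst w; x = pfst (psnd w); n = psnd (psnd w) in
         if v = 0 then return_state n k'
         else eval_state p1 (prod_encode (x, Suc n)) (push 4 (triple p1 x (Suc n)) k')))"

definition step :: "nat \<Rightarrow> nat" where
  "step c = (if pfst c = 0 then eval_step (pfst (psnd c)) (pfst (psnd (psnd c))) (psnd (psnd (psnd c)))
             else return_step (pfst (psnd c)) (psnd (psnd c)))"

section \<open>Runs of the machine and correctness of programs\<close>

lemma step_eval [simp]: "step (eval_state p x k) = eval_step p x k"
  by (simp add: step_def eval_state_def)

lemma step_return [simp]: "step (return_state v k) = return_step v k"
  by (simp add: step_def return_state_def)

definition reaches :: "nat \<Rightarrow> nat \<Rightarrow> bool" where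
  "reaches c d \<longleftrightarrow> (\<exists>n. (step ^^ n) c = d)"

lemma reaches_refl: "reaches c c"
  unfolding reaches_def by (rule exI[of _ 0]) simp

lemma reaches_trans [trans]: "reaches c d \<Longrightarrow> reaches d e \<Longrightarrow> reaches c e"
  unfolding reaches_def by (metis comp_apply funpow_add)

lemma reaches_step: "reaches (step c) d \<Longrightarrow> reaches c d"
  unfolding reaches_def by (metis comp_apply funpow_Suc_right)

text \<open>The quantifier over stacks \<open>k\<close> lets a subprogram run on top of pending
  frames, which is what the inductive proof for composite programs uses.\<close>

definition computes :: "nat \<Rightarrow> (nat \<rightharpoonup> nat) \<Rightarrow> bool" where
  "computes p f \<longleftrightarrow> (\<forall>x y k. f x = Some y \<longrightarrow> reaches (eval_state p x k) (return_state y k))"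

lemma computesD: "computes p f \<Longrightarrow> f x = Some y \<Longrightarrow> reaches (eval_state p x k) (return_state y k)"
  by (simp add: computes_def)

lemma computes_initial:
  assumes "\<And>x k. eval_step p x k = return_state (g x) k" shows "computes p (\<lambda>x. Some (g x))"
  unfolding computes_def
proof (intro allI impI)
  fix x y k assume "Some (g x) = Some y"
  then show "reaches (eval_state p x k) (return_state y k)"
    using assms by (intro reaches_step[of "eval_state p x k"]) (simp add: reaches_refl)
qed

lemma computes_pair:
  assumes "computes p1 f" "computes p2 g"
  shows "computes (triple 4 p1 p2)
    (\<lambda>n. Option.bind (f n) (\<lambda>a. Option.bind (g n) (\<lambda>b. Some (prod_encode (a, b)))))"
  unfolding computes_def
proof (intro allI impI)
  fix x y k
  assume "Option.bind (f x) (\<lambda>a. Option.bind (g x) (\<lambda>b. Some (prod_encode (a, b)))) = Some y"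
  then obtain a b where ab: "f x = Some a" "g x = Some b" "y = prod_encode (a, b)"
    by (auto simp: Option.bind_eq_Some_conv)
  have "reaches (eval_state p1 x (push 0 (prod_encode (p2, x)) k))
      (return_state a (push 0 (prod_encode (p2, x)) k))"
    by (rule computesD[OF assms(1) ab(1)])
  also have "reaches \<dots> (eval_state p2 x (push 1 a k))"
    by (rule reaches_step) (simp add: return_step_def push_def reaches_refl)
  also have "reaches \<dots> (return_state b (push 1 a k))"
    by (rule computesD[OF assms(2) ab(2)])
  also have "reaches \<dots> (return_state y k)"
    by (rule reaches_step) (simp add: return_step_def push_def ab reaches_refl)
  finally show "reaches (eval_state (triple 4 p1 p2) x k) (return_state y k)"
    by (intro reaches_step[of "eval_state (triple 4 p1 p2) x k"]) (simp add: eval_step_def)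
qed

lemma computes_comp:
  assumes "computes p1 f" "computes p2 g"
  shows "computes (triple 5 p1 p2) (f \<circ>\<^sub>m g)"
  unfolding computes_def
proof (intro allI impI)
  fix x y k
  assume "(f \<circ>\<^sub>m g) x = Some y"
  then obtain b where b: "g x = Some b" "f b = Some y" by (auto simp: map_comp_Some_iff)
  have "reaches (eval_state p2 x (push 2 p1 k)) (return_state b (push 2 p1 k))"
    by (rule computesD[OF assms(2) b(1)])
  also have "reaches \<dots> (eval_state p1 b k)"
    by (rule reaches_step) (simp add: return_step_def push_def reaches_refl)
  also have "reaches \<dots> (return_state y k)"
    by (rule computesD[OF assms(1) b(2)])
  finally show "reaches (eval_state (triple 5 p1 p2) x k) (return_state y k)"
    by (intro reaches_step[of "eval_state (triple 5 p1 p2) x k"]) (simp add: eval_step_def)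
qed

lemma computes_prec:
  assumes "computes p1 f" "computes p2 g"
  shows "computes (triple 6 p1 p2) (\<lambda>z. case prod_decode z of (a, n) \<Rightarrow>
      rec_nat (f a) (\<lambda>y r. Option.bind r (\<lambda>i. g (prod_encode (a, prod_encode (y, i))))) n)"
  unfolding computes_def
proof (intro allI impI)
  fix x v k
  define a where "a = pfst x"
  define n where "n = psnd x"
  define R where "R = rec_nat (f a) (\<lambda>y r. Option.bind r (\<lambda>i. g (triple a y i)))"
  have R: "R 0 = f a" "R (Suc y) = Option.bind (R y) (\<lambda>i. g (triple a y i))" for y
    by (simp_all add: R_def)
  assume "(case prod_decode x of (a, n) \<Rightarrow>
      rec_nat (f a) (\<lambda>y r. Option.bind r (\<lambda>i. g (prod_encode (a, prod_encode (y, i))))) n) = Some v"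
  then have v: "R n = Some v" by (simp add: R_def a_def n_def case_prod_unfold)
  \<comment> \<open>Loop invariant: when the frame shows counter \<open>y\<close>, the value being
    returned is \<open>R y\<close>.\<close>
  have loop: "reaches (eval_state (triple 6 p1 p2) x k)
      (return_state i (push 3 (prod_encode (p2, triple a y n)) k))" if "y \<le> n" "R y = Some i" for y i
    using that
  proof (induction y arbitrary: i)
    case 0
    then have "reaches (eval_state p1 a (push 3 (prod_encode (p2, triple a 0 n)) k))
        (return_state i (push 3 (prod_encode (p2, triple a 0 n)) k))"
      by (intro computesD[OF assms(1)]) (simp add: R)
    then show ?case
      by (intro reaches_step[of "eval_state (triple 6 p1 p2) x k"])
        (simp add: eval_step_def a_def n_def)
  next
    case (Suc y)
    then obtain j where j: "R y = Some j" "g (triple a y j) = Some i"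
      by (auto simp: R Option.bind_eq_Some_conv)
    have "reaches (eval_state (triple 6 p1 p2) x k)
        (return_state j (push 3 (prod_encode (p2, triple a y n)) k))"
      using Suc j by simp
    also have "reaches \<dots> (eval_state p2 (triple a y j) (push 3 (prod_encode (p2, triple a (Suc y) n)) k))"
      by (rule reaches_step) (use Suc.prems in \<open>simp add: return_step_def push_def reaches_refl\<close>)
    also have "reaches \<dots> (return_state i (push 3 (prod_encode (p2, triple a (Suc y) n)) k))"
      by (rule computesD[OF assms(2) j(2)])
    finally show ?case .
  qed
  have "reaches (eval_state (triple 6 p1 p2) x k)
      (return_state v (push 3 (prod_encode (p2, triple a n n)) k))"
    using loop[OF order_refl v] .
  also have "reaches \<dots> (return_state v k)"
    by (rule reaches_step) (simp add: return_step_def push_def reaches_refl)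
  finally show "reaches (eval_state (triple 6 p1 p2) x k) (return_state v k)" .
qed

lemma computes_mu:
  assumes "computes p1 f"
  shows "computes (triple 7 p1 0) (\<lambda>a. mu_search (\<lambda>n. f (prod_encode (a, n))))"
  unfolding computes_def
proof (intro allI impI)
  fix x v k
  let ?g = "\<lambda>n. f (prod_encode (x, n))"
  assume mu: "mu_search ?g = Some v"
  then obtain n where n: "?g n = Some 0" "\<And>m. m < n \<Longrightarrow> ?g m \<noteq> None"
    and v: "v = (LEAST n. ?g n = Some 0)"
    by (auto simp: mu_search_def split: if_splits)
  have v0: "?g v = Some 0" unfolding v by (rule LeastI[of "\<lambda>n. ?g n = Some 0", OF n(1)])
  have "v \<le> n" unfolding v by (rule Least_le[of "\<lambda>n. ?g n = Some 0", OF n(1)])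
  then have def: "m < v \<Longrightarrow> ?g m \<noteq> None" for m using n(2)[of m] by simp
  have pos: "m < v \<Longrightarrow> ?g m \<noteq> Some 0" for m unfolding v by (rule not_less_Least)
  \<comment> \<open>Every candidate up to \<open>v\<close> gets tried, since the earlier ones have
    defined, nonzero values.\<close>
  have loop: "m \<le> v \<Longrightarrow> reaches (eval_state (triple 7 p1 0) x k)
      (eval_state p1 (prod_encode (x, m)) (push 4 (triple p1 x m) k))" for m
  proof (induction m)
    case 0
    show ?case
      by (rule reaches_step[of "eval_state (triple 7 p1 0) x k"])
        (simp add: eval_step_def reaches_refl)
  next
    case (Suc m)
    then obtain i where i: "?g m = Some i" "i \<noteq> 0" using def[of m] pos[of m] by auto
    have "reaches (eval_state (triple 7 p1 0) x k)
      (eval_state p1 (prod_encode (x, m)) (push 4 (triple p1 x m) k))" using Suc by simp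
    also have "reaches \<dots> (return_state i (push 4 (triple p1 x m) k))"
      by (rule computesD[OF assms i(1)])
    also have "reaches \<dots> (eval_state p1 (prod_encode (x, Suc m)) (push 4 (triple p1 x (Suc m)) k))"
      by (rule reaches_step) (use i(2) in \<open>simp add: return_step_def push_def reaches_refl\<close>)
    finally show ?case .
  qed
  have "reaches (eval_state (triple 7 p1 0) x k)
      (eval_state p1 (prod_encode (x, v)) (push 4 (triple p1 x v) k))" by (rule loop) simp
  also have "reaches \<dots> (return_state 0 (push 4 (triple p1 x v) k))"
    by (rule computesD[OF assms v0])
  also have "reaches \<dots> (return_state v k)"
    by (rule reaches_step) (simp add: return_step_def push_def reaches_refl)
  finally show "reaches (eval_state (triple 7 p1 0) x k) (return_state v k)" .
qed

lemma partrec_computes: "partrec f \<Longrightarrow> \<exists>p. computes p f"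
proof (induction rule: partrec.induct)
  case zero
  have "computes (triple 0 0 0) (\<lambda>_. Some 0)"
    by (rule computes_initial) (simp add: eval_step_def)
  then show ?case ..
next
  case succ
  have "computes (triple 1 0 0) (\<lambda>n. Some (Suc n))"
    by (rule computes_initial) (simp add: eval_step_def)
  then show ?case ..
next
  case proj1
  have "computes (triple 2 0 0) (\<lambda>n. Some (pfst n))"
    by (rule computes_initial) (simp add: eval_step_def)
  then show ?case ..
next
  case proj2
  have "computes (triple 3 0 0) (\<lambda>n. Some (psnd n))"
    by (rule computes_initial) (simp add: eval_step_def)
  then show ?case ..
qed (blast intro: computes_pair computes_comp computes_prec computes_mu)+

text \<open>Outputs are shifted by one, so that 0 means that the machine has not halted within
  \<open>s\<close> steps.\<close>

definition sim :: "nat \<Rightarrow> nat \<Rightarrow> nat \<Rightarrow> nat" where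
  "sim p x s = (let c = (step ^^ s) (eval_state p x 0) in
     if pfst c = 1 \<and> psnd (psnd c) = 0 then Suc (pfst (psnd c)) else 0)"

lemma sim_eq_Suc_iff: "sim p x s = Suc y \<longleftrightarrow> (step ^^ s) (eval_state p x 0) = return_state y 0"
  by (auto simp: sim_def Let_def return_state_def)
    (metis One_nat_def prod.collapse prod_decode_inverse)

text \<open>Returning a value to the empty stack is a fixed point of \<open>step\<close>.\<close>

lemma sim_stable: assumes "sim p x s = Suc y" "s \<le> s'" shows "sim p x s' = Suc y"
proof -
  have "(step ^^ n) (return_state y 0) = return_state y 0" for n
    by (induction n) (auto simp: return_step_def)
  moreover obtain n where "s' = n + s" using assms(2) by (metis le_add_diff_inverse2)
  ultimately show ?thesis using assms(1) by (simp add: sim_eq_Suc_iff funpow_add)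
qed

lemma sim_universal:
  assumes "total_rec g"
  obtains p where "\<And>x. \<exists>s. sim p x s = Suc (g x)"
proof -
  obtain p where "computes p (\<lambda>x. Some (g x))"
    using assms partrec_computes by (auto simp: total_rec_def)
  then have "\<exists>s. sim p x s = Suc (g x)" for x
    by (auto simp: computes_def reaches_def sim_eq_Suc_iff)
  then show ?thesis by (rule that)
qed

lemma total_rec_eval_state [rec_intros]:
  "total_rec f \<Longrightarrow> total_rec g \<Longrightarrow> total_rec h \<Longrightarrow> total_rec (\<lambda>n. eval_state (f n) (g n) (h n))"
  unfolding eval_state_def by (intro rec_intros)

lemma total_rec_return_state [rec_intros]:
  "total_rec f \<Longrightarrow> total_rec g \<Longrightarrow> total_rec (\<lambda>n. return_state (f n) (g n))"
  unfolding return_state_def by (intro rec_intros)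

lemma total_rec_push [rec_intros]:
  "total_rec f \<Longrightarrow> total_rec g \<Longrightarrow> total_rec h \<Longrightarrow> total_rec (\<lambda>n. push (f n) (g n) (h n))"
  unfolding push_def by (intro rec_intros)

lemma total_rec_step [rec_intros]: "total_rec f \<Longrightarrow> total_rec (\<lambda>n. step (f n))"
  unfolding step_def eval_step_def return_step_def Let_def by (intro rec_intros)

lemma total_rec_sim [rec_intros]:
  assumes "total_rec f" "total_rec g" "total_rec h"
  shows "total_rec (\<lambda>n. sim (f n) (g n) (h n))"
proof -
  have "(step ^^ s) c = rec_nat c (\<lambda>_. step) s" for s c by (induction s) auto
  then show ?thesis
    unfolding sim_def Let_def by (simp add: rec_intros assms)
qed

section \<open>Costs of changes\<close>

lemma exists_change:
  fixes m n :: nat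
  assumes "m \<le> n" "P m \<noteq> P n"
  shows "\<exists>t\<in>{m..<n}. P t \<noteq> P (Suc t)"
proof (rule ccontr)
  assume *: "\<not> ?thesis"
  have "k \<le> n \<Longrightarrow> P k = P m" if "m \<le> k" for k
    using that by (induction k rule: dec_induct) (use * in auto)
  from this[of n] show False using assms by auto
qed

lemma stage_cost_nonneg: "incseq q \<Longrightarrow> 0 \<le> stage_cost (seq_cost q) As s"
  by (simp add: stage_cost_def seq_cost_nonneg)

text \<open>The stage is charged for the least changed number, which is at most \<open>x\<close>,
  and smaller numbers are more expensive.\<close>

lemma stage_cost_ge:
  assumes "incseq q" "(x \<in> As t) \<noteq> (x \<in> As (Suc t))" "x \<le> t"
  shows "q (Suc t) - q x \<le> stage_cost (seq_cost q) As (Suc t)"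
proof -
  let ?l = "LEAST x. (x \<in> As t) \<noteq> (x \<in> As (Suc t))"
  have l: "?l \<le> x" using assms(2) by (rule Least_le)
  then have "stage_cost (seq_cost q) As (Suc t) = q (Suc t) - q ?l"
    using assms(2,3) by (auto simp: stage_cost_def seq_cost_def intro!: exI[of _ x])
  then show ?thesis using incseqD[OF assms(1) l] by simp
qed

text \<open>A net change on \<open>x\<close> between stages \<open>m\<close> and \<open>n\<close>
  occurs at some single stage after \<open>m\<close>, where the price of \<open>x\<close> is at
  least that at stage \<open>m\<close>.\<close>

lemma sum_stage_cost_ge:
  assumes q: "incseq q" and "x \<le> m" "m \<le> n" "(x \<in> As m) \<noteq> (x \<in> As n)"
  shows "q m - q x \<le> (\<Sum>t\<in>{m..<n}. stage_cost (seq_cost q) As (Suc t))"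
proof -
  obtain t where t: "t \<in> {m..<n}" "(x \<in> As t) \<noteq> (x \<in> As (Suc t))"
    using exists_change[where P = "\<lambda>t. x \<in> As t", OF assms(3,4)] by blast
  have "q m - q x \<le> q (Suc t) - q x" using t(1) incseqD[OF q, of m "Suc t"] by simp
  also have "\<dots> \<le> stage_cost (seq_cost q) As (Suc t)"
    using t assms by (intro stage_cost_ge) auto
  also have "\<dots> \<le> (\<Sum>t\<in>{m..<n}. stage_cost (seq_cost q) As (Suc t))"
    using t(1) q by (intro member_le_sum) (auto intro: stage_cost_nonneg)
  finally show ?thesis .
qed

lemma left_ce_approx_rec: "left_ce_approx a \<alpha> \<Longrightarrow> total_rec f \<Longrightarrow> rec_rat (\<lambda>n. a (f n))"
  by (rule rec_rat_compose) (simp_all add: left_ce_approx_def computable_id_iff rec_rat_def)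

lemma cost_implies_if_bounded:
  fixes N :: nat
  assumes a: "left_ce_approx a \<alpha>" and b: "left_ce_approx b \<beta>"
    and bound: "\<And>x. \<beta> - real_of_rat (b x) \<le> N * (\<alpha> - real_of_rat (a x))"
  shows "seq_cost a \<rightarrow>\<^sub>c seq_cost b"
  unfolding cost_implies_def
proof (intro allI impI)
  fix A assume "A \<Turnstile>\<^sub>c seq_cost a"
  then obtain As where As: "computable_approx As A"
    and sum: "summable (\<lambda>s. real_of_rat (stage_cost (seq_cost a) As (Suc s)))"
    by (auto simp: obeys_def)
  have inca: "incseq a" and incb: "incseq b" using a b by (auto simp: left_ce_approx_def)
  define ok where "ok i s \<longleftrightarrow> (\<forall>x<Suc i. b (Suc i) - b x < of_nat N * (a s - a x))" for i s
  have ok_mono: "ok i s'" if "ok i s" "s \<le> s'" for i s s'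
    unfolding ok_def
  proof (intro allI impI)
    fix x assume "x < Suc i"
    then have "b (Suc i) - b x < of_nat N * (a s - a x)" using that(1) by (simp add: ok_def)
    also have "\<dots> \<le> of_nat N * (a s' - a x)"
      using incseqD[OF inca that(2)] by (intro mult_left_mono) auto
    finally show "b (Suc i) - b x < of_nat N * (a s' - a x)" .
  qed
  \<comment> \<open>As \<open>b (Suc i)\<close> is strictly below \<beta>, the left side is strictly
    below the limit \<open>N * (\<alpha> - a x)\<close> of the right side, so the inequality holds
    at some finite stage; only finitely many \<open>x\<close> are involved.\<close>
  have ok_ex: "\<exists>s. ok i s" for i
  proof -
    have "\<forall>x\<in>{..<Suc i}. \<forall>\<^sub>F s in sequentially. b (Suc i) - b x < of_nat N * (a s - a x)"
    proof
      fix x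
      have "(\<lambda>s. real N * (real_of_rat (a s) - real_of_rat (a x)))
          \<longlonglongrightarrow> real N * (\<alpha> - real_of_rat (a x))"
        using a by (intro tendsto_intros) (simp add: left_ce_approx_def)
      moreover have "real_of_rat (b (Suc i)) - real_of_rat (b x) < real N * (\<alpha> - real_of_rat (a x))"
        using bound[of x] b by (auto simp: left_ce_approx_def dest: spec[of _ "Suc i"])
      ultimately have "\<forall>\<^sub>F s in sequentially.
          real_of_rat (b (Suc i)) - real_of_rat (b x) < real N * (real_of_rat (a s) - real_of_rat (a x))"
        by (rule order_tendstoD)
      then show "\<forall>\<^sub>F s in sequentially. b (Suc i) - b x < of_nat N * (a s - a x)"
      proof (rule eventually_mono)
        fix s
        assume "real_of_rat (b (Suc i)) - real_of_rat (b x) < real N * (real_of_rat (a s) - real_of_rat (a x))"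
        then have "real_of_rat (b (Suc i) - b x) < real_of_rat (of_nat N * (a s - a x))"
          by (simp add: of_rat_diff of_rat_mult)
        then show "b (Suc i) - b x < of_nat N * (a s - a x)" by (simp only: of_rat_less)
      qed
    qed
    from eventually_ball_finite[OF _ this] have "\<forall>\<^sub>F s in sequentially. ok i s"
      by (simp add: ok_def Ball_def)
    then show ?thesis by (meson eventually_happens trivial_limit_sequentially)
  qed
  define m where "m i = (LEAST s. ok i s)" for i
  \<comment> \<open>Summing the successors of all \<open>m j\<close> makes \<open>\<sigma>\<close>
    strictly increasing and keeps it above \<open>m\<close>.\<close>
  define \<sigma> where "\<sigma> i = (\<Sum>j<Suc i. Suc (m j))" for i
  have m: "ok i (m i)" for i unfolding m_def using ok_ex by (rule LeastI_ex)
  have \<sigma>_Suc: "\<sigma> i < \<sigma> (Suc i)" for i by (simp add: \<sigma>_def)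
  have \<sigma>_mono: "strict_mono \<sigma>" using \<sigma>_Suc by (simp add: strict_mono_Suc_iff)
  have \<sigma>: "ok i (\<sigma> i)" for i by (rule ok_mono[OF m]) (simp add: \<sigma>_def)
  have \<sigma>_ge: "i \<le> \<sigma> i" for i by (rule strict_mono_imp_increasing[OF \<sigma>_mono])
  have "total_rec m"
    unfolding m_def ok_def
    by (intro rec_intros left_ce_approx_rec[OF a] left_ce_approx_rec[OF b])
      (use ok_ex in \<open>simp add: ok_def\<close>)
  note m_rec = total_rec_compose[OF this]
  have \<sigma>_rec: "total_rec \<sigma>"
    unfolding \<sigma>_def by (intro rec_intros m_rec)
  define Bs where "Bs i = As (\<sigma> i)" for i
  have "computable_approx Bs A"
    unfolding computable_approx_def
  proof (intro conjI allI)
    show "finite (Bs s)" for s using As by (simp add: Bs_def computable_approx_def)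
    show "computable id set_encode Bs"
      using As \<sigma>_rec total_rec_compose[of "\<lambda>n. set_encode (As n)" \<sigma>]
      by (simp add: Bs_def computable_approx_def computable_id_iff)
    show "\<forall>\<^sub>F s in sequentially. (x \<in> Bs s) = (x \<in> A)" for x
    proof -
      have "\<forall>\<^sub>F s in sequentially. (x \<in> As s) = (x \<in> A)"
        using As by (simp add: computable_approx_def)
      from eventually_compose_filterlim[OF this filterlim_subseq[OF \<sigma>_mono]]
      show ?thesis by (simp add: Bs_def)
    qed
  qed
  moreover have "summable (\<lambda>s. real_of_rat (stage_cost (seq_cost b) Bs (Suc s)))"
  proof (rule summableI_nonneg_bounded)
    let ?f = "\<lambda>s. stage_cost (seq_cost a) As (Suc s)"
    fix n
    show "0 \<le> real_of_rat (stage_cost (seq_cost b) Bs (Suc n))" by (simp add: stage_cost_nonneg incb)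
    \<comment> \<open>A change of \<open>Bs\<close> at stage \<open>Suc i\<close> is a net change of
      \<open>As\<close> between \<open>\<sigma> i\<close> and \<open>\<sigma> (Suc i)\<close>. These
      intervals are disjoint, so the payments add up.\<close>
    have step: "stage_cost (seq_cost b) Bs (Suc i) \<le> of_nat N * (\<Sum>t\<in>{\<sigma> i..<\<sigma> (Suc i)}. ?f t)" for i
    proof (cases "\<exists>x<Suc i. (x \<in> Bs i) \<noteq> (x \<in> Bs (Suc i))")
      case True
      let ?x = "LEAST x. (x \<in> Bs i) \<noteq> (x \<in> Bs (Suc i))"
      obtain y where y: "y < Suc i" "(y \<in> Bs i) \<noteq> (y \<in> Bs (Suc i))" using True by blast
      have x: "(?x \<in> Bs i) \<noteq> (?x \<in> Bs (Suc i))" using y(2) by (rule LeastI)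
      have "?x \<le> y" using y(2) by (rule Least_le)
      with y have xi: "?x \<le> i" by simp
      have "stage_cost (seq_cost b) Bs (Suc i) = b (Suc i) - b ?x"
        using True xi by (simp add: stage_cost_def seq_cost_def)
      also have "\<dots> \<le> of_nat N * (a (\<sigma> i) - a ?x)"
        using \<sigma>[of i] xi by (auto simp: ok_def less_Suc_eq_le intro: less_imp_le)
      also have "\<dots> \<le> of_nat N * (\<Sum>t\<in>{\<sigma> i..<\<sigma> (Suc i)}. ?f t)"
        using x xi \<sigma>_ge[of i] \<sigma>_Suc[of i] inca
        by (intro mult_left_mono sum_stage_cost_ge) (auto simp: Bs_def)
      finally show ?thesis .
    next
      case False
      then have "stage_cost (seq_cost b) Bs (Suc i) = 0" by (auto simp: stage_cost_def)
      then show ?thesis by (simp add: sum_nonneg stage_cost_nonneg inca)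
    qed
    have "(\<Sum>i<n. stage_cost (seq_cost b) Bs (Suc i)) \<le> of_nat N * (\<Sum>t\<in>{\<sigma> 0..<\<sigma> n}. ?f t)"
    proof (induction n)
      case (Suc n)
      have "\<sigma> 0 \<le> \<sigma> n" using \<sigma>_mono by (simp add: strict_mono_less_eq)
      then have "(\<Sum>t\<in>{\<sigma> 0..<\<sigma> (Suc n)}. ?f t)
          = (\<Sum>t\<in>{\<sigma> 0..<\<sigma> n}. ?f t) + (\<Sum>t\<in>{\<sigma> n..<\<sigma> (Suc n)}. ?f t)"
        using \<sigma>_Suc[of n] by (simp add: sum.atLeastLessThan_concat)
      then show ?case using Suc step[of n] by (simp add: distrib_left)
    qed simp
    also have "\<dots> \<le> of_nat N * (\<Sum>t<\<sigma> n. ?f t)"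
      by (intro mult_left_mono sum_mono2) (auto simp: stage_cost_nonneg inca)
    finally have "real_of_rat (\<Sum>i<n. stage_cost (seq_cost b) Bs (Suc i))
        \<le> real_of_rat (of_nat N * (\<Sum>t<\<sigma> n. ?f t))"
      by (simp only: of_rat_less_eq)
    also have "\<dots> = N * (\<Sum>t<\<sigma> n. real_of_rat (?f t))"
      by (simp add: of_rat_mult of_rat_sum)
    also have "\<dots> \<le> N * (\<Sum>t. real_of_rat (?f t))"
      by (intro mult_left_mono sum_le_suminf sum) (auto simp: stage_cost_nonneg inca)
    finally show "(\<Sum>i<n. real_of_rat (stage_cost (seq_cost b) Bs (Suc i)))
        \<le> N * (\<Sum>t. real_of_rat (?f t))" by (simp add: of_rat_sum)
  qed
  ultimately show "A \<Turnstile>\<^sub>c seq_cost b" by (auto simp: obeys_def)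
qed

section \<open>Solovay reducibility and approximations\<close>

text \<open>Subtracting \<open>1 / Suc s\<close> forces the terms strictly below \<alpha> without
  changing the limit; the maximum with 0 stays below \<alpha> because \<alpha> is positive.\<close>

lemma left_ce_approx_exists:
  assumes "left_ce \<alpha>" "0 < \<alpha>"
  shows "\<exists>a. left_ce_approx a \<alpha>"
proof -
  obtain q where q: "computable id rat_encode q" "incseq q" "(\<lambda>s. real_of_rat (q s)) \<longlonglongrightarrow> \<alpha>"
    using assms(1) by (auto simp: left_ce_def)
  define a where "a s = max 0 (q s - of_nat 1 / of_nat (Suc s))" for s
  have of_rat_a: "real_of_rat (a s) = max 0 (real_of_rat (q s) - 1 / real (Suc s))" for s
  proof -
    have "real_of_rat (max 0 x) = max 0 (real_of_rat x)" for x by (simp add: max_def)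
    then show ?thesis by (simp add: a_def of_rat_diff of_rat_divide of_rat_add)
  qed
  have qle: "real_of_rat (q s) \<le> \<alpha>" for s
    using q(2,3) by (intro incseq_le) (auto simp: incseq_def of_rat_less_eq)
  have "left_ce_approx a \<alpha>"
    unfolding left_ce_approx_def
  proof (intro conjI allI)
    have "rec_rat q" using q(1) by (simp add: computable_id_iff rec_rat_def)
    then have "rec_rat a" unfolding a_def by (intro rec_intros) auto
    then show "computable id rat_encode a" by (simp add: computable_id_iff rec_rat_def)
    show "incseq a"
      unfolding a_def
    proof (intro incseq_SucI max.mono order_refl diff_mono)
      show "q s \<le> q (Suc s)" for s using q(2) by (simp add: incseq_SucD)
      show "of_nat 1 / of_nat (Suc (Suc s)) \<le> (of_nat 1 / of_nat (Suc s) :: rat)" for s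
        by (simp add: frac_le)
    qed
    show "0 \<le> a s" for s by (simp add: a_def)
    have "(\<lambda>s. max 0 (real_of_rat (q s) - 1 / real (Suc s))) \<longlonglongrightarrow> max 0 (\<alpha> - 0)"
      by (intro tendsto_intros q LIMSEQ_Suc[OF lim_inverse_n'])
    then show "(\<lambda>s. real_of_rat (a s)) \<longlonglongrightarrow> \<alpha>" using assms(2) by (simp add: of_rat_a)
    have "real_of_rat (q s) - 1 / real (Suc s) < \<alpha>" for s using qle[of s] by (smt (verit) divide_pos_pos of_nat_0_less_iff zero_less_Suc)
    then show "real_of_rat (a s) < \<alpha>" for s using assms(2) by (simp add: of_rat_a)
  qed
  then show ?thesis by blast
qed

text \<open>The exponent can be made as large as desired, which allows it to serve as a stage number
  as well. Once the gap times \<open>2 ^ n\<close> exceeds 1, rounding \<open>x * 2 ^ n\<close> up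
  stays below \<open>y * 2 ^ n\<close>.\<close>

lemma dyadic_between:
  fixes x y :: rat
  assumes "0 \<le> x" "x < y"
  shows "\<exists>k n. t \<le> n \<and> x \<le> of_nat k / 2 ^ n \<and> of_nat k / 2 ^ n < y"
proof -
  obtain n0 where n0: "inverse (y - x) < of_nat n0" using reals_Archimedean2 by blast
  define n where "n = max n0 t"
  have "of_nat n0 \<le> (of_nat n :: rat)" by (simp add: n_def)
  also have "of_nat n < (2 ^ n :: rat)"
    by (metis of_nat_less_iff of_nat_numeral of_nat_power less_exp)
  finally have "inverse (y - x) < 2 ^ n" by (rule less_trans[OF n0])
  then have small: "1 < (y - x) * 2 ^ n" using assms(2) by (simp add: field_simps)
  define k where "k = nat \<lceil>x * 2 ^ n\<rceil>"
  have "0 \<le> x * 2 ^ n" using assms(1) by simp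
  then have "-1 < x * 2 ^ n" by linarith
  then have "0 \<le> \<lceil>x * 2 ^ n\<rceil>" by simp
  then have k: "of_nat k = (of_int \<lceil>x * 2 ^ n\<rceil> :: rat)" by (simp add: k_def)
  have "x * 2 ^ n \<le> of_nat k" unfolding k by (rule le_of_int_ceiling)
  moreover have "of_nat k < x * 2 ^ n + 1" unfolding k by linarith
  then have "of_nat k < y * 2 ^ n" using small by (simp add: algebra_simps)
  ultimately show ?thesis
    by (intro exI[of _ k] exI[of _ n]) (simp add: n_def field_simps)
qed

lemma dyadic_approx_above:
  assumes a: "left_ce_approx a \<alpha>"
  shows "\<exists>q. rec_rat q \<and> (\<forall>s. q s \<in> dyadics_below \<alpha>) \<and> (\<forall>s. a s \<le> q s)"
proof -
  let ?d = "\<lambda>w. of_nat (pfst w) / of_nat (2 ^ psnd w) :: rat"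
  \<comment> \<open>To make the search decidable, being below \<alpha> is certified by a stage of
    \<open>a\<close>; the exponent \<open>psnd w\<close> of the fraction doubles as this
    stage.\<close>
  let ?P = "\<lambda>s w. a s \<le> ?d w \<and> ?d w \<le> a (psnd w)"
  have ex: "\<exists>w. ?P s w" for s
  proof -
    have lim: "(\<lambda>s. real_of_rat (a s)) \<longlonglongrightarrow> \<alpha>" and less: "real_of_rat (a s) < \<alpha>" and inc: "incseq a"
      and "0 \<le> a s" using a by (auto simp: left_ce_approx_def)
    from order_tendstoD(1)[OF lim less] obtain t where "real_of_rat (a s) < real_of_rat (a t)"
      by (meson eventually_happens trivial_limit_sequentially)
    then have "a s < a t" by (simp add: of_rat_less)
    then obtain k n where "t \<le> n" "a s \<le> of_nat k / 2 ^ n" "of_nat k / 2 ^ n < a t"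
      using dyadic_between[OF \<open>0 \<le> a s\<close>, of "a t" t] by blast
    then have "?P s (prod_encode (k, n))" using incseqD[OF inc, of t n] by simp
    then show ?thesis ..
  qed
  define w where "w s = (LEAST w. ?P s w)" for s
  have w: "?P s (w s)" for s unfolding w_def using ex by (rule LeastI_ex)
  have "total_rec w"
    unfolding w_def by (intro rec_intros left_ce_approx_rec[OF a] ex) auto
  then have "rec_rat (\<lambda>s. ?d (w s))" by (intro rec_intros) auto
  moreover have "?d (w s) \<in> dyadics_below \<alpha>" for s
  proof -
    have "?d (w s) = of_int (int (pfst (w s))) / 2 ^ psnd (w s)" by simp
    then have "?d (w s) \<in> dyadic_rats" unfolding dyadic_rats_def by blast
    moreover have "real_of_rat (?d (w s)) < \<alpha>"
      using w[of s] a by (meson left_ce_approx_def of_rat_less_eq le_less_trans)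
    ultimately show ?thesis by (simp add: dyadics_below_def)
  qed
  ultimately show ?thesis using w by (intro exI[of _ "\<lambda>s. ?d (w s)"]) blast
qed

lemma dyadic_rats_iff: "q \<in> dyadic_rats \<longleftrightarrow> (\<exists>n. snd (quotient_of q) dvd 2 ^ n)"
proof -
  obtain r j where rj: "quotient_of q = (r, j)" by fastforce
  then have j: "j > 0" and cop: "coprime r j" and q: "q = of_int r / of_int j"
    using quotient_of_denom_pos quotient_of_coprime quotient_of_div by auto
  show ?thesis
  proof
    assume "q \<in> dyadic_rats"
    then obtain k n where "q = of_int k / 2 ^ n" by (auto simp: dyadic_rats_def)
    then have "of_int r * 2 ^ n = (of_int k * of_int j :: rat)"
      using q j by (simp add: field_simps)
    then have "of_int (r * 2 ^ n) = (of_int (k * j) :: rat)" by simp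
    then have "r * 2 ^ n = k * j" by (simp only: of_int_eq_iff)
    then have "j dvd r * 2 ^ n" by simp
    then have "j dvd 2 ^ n" using cop by (simp add: coprime_dvd_mult_right_iff coprime_commute)
    then show "\<exists>n. snd (quotient_of q) dvd 2 ^ n" by (auto simp: rj)
  next
    assume "\<exists>n. snd (quotient_of q) dvd 2 ^ n"
    then obtain n w where w: "2 ^ n = j * w" by (auto simp: rj dvd_def)
    have "w \<noteq> 0" using w by auto
    have "(2 ^ n :: rat) = of_int (2 ^ n)" by simp
    also have "\<dots> = of_int j * of_int w" unfolding w by simp
    finally have "q = of_int (r * w) / 2 ^ n" using j q \<open>w \<noteq> 0\<close> by simp
    then show "q \<in> dyadic_rats" unfolding dyadic_rats_def by blast
  qed
qed

text \<open>One number \<open>s\<close> certifies both that \<open>q\<close> is dyadic and that it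
  is below \<alpha>, so the domain of a reduction can be enumerated by a single search.\<close>

lemma dyadics_below_iff:
  assumes a: "left_ce_approx a \<alpha>"
  shows "q \<in> dyadics_below \<alpha> \<longleftrightarrow> (\<exists>s. 0 \<le> q \<and> q \<le> a s \<and> snd (quotient_of q) dvd 2 ^ s)"
proof
  have inc: "incseq a" and less: "real_of_rat (a s) < \<alpha>"
    and lim: "(\<lambda>s. real_of_rat (a s)) \<longlonglongrightarrow> \<alpha>" for s
    using a by (auto simp: left_ce_approx_def)
  {
    assume q: "q \<in> dyadics_below \<alpha>"
    then obtain n where n: "snd (quotient_of q) dvd 2 ^ n"
      by (auto simp: dyadics_below_def dyadic_rats_iff)
    from q have "real_of_rat q < \<alpha>" by (simp add: dyadics_below_def)
    from order_tendstoD(1)[OF lim this] obtain t where t: "real_of_rat q < real_of_rat (a t)"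
      by (meson eventually_happens trivial_limit_sequentially)
    have "q \<le> a t" using t by (simp add: of_rat_less)
    also have "a t \<le> a (max t n)" using inc by (simp add: incseqD)
    finally have "q \<le> a (max t n)" .
    moreover have "snd (quotient_of q) dvd 2 ^ max t n"
      using n by (rule dvd_trans) (simp add: le_imp_power_dvd)
    ultimately show "\<exists>s. 0 \<le> q \<and> q \<le> a s \<and> snd (quotient_of q) dvd 2 ^ s"
      using q by (auto simp: dyadics_below_def)
  next
    assume "\<exists>s. 0 \<le> q \<and> q \<le> a s \<and> snd (quotient_of q) dvd 2 ^ s"
    then obtain s where s: "0 \<le> q" "q \<le> a s" "snd (quotient_of q) dvd 2 ^ s" by blast
    then have "real_of_rat q < \<alpha>" using less[of s] by (meson of_rat_less_eq le_less_trans)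
    then show "q \<in> dyadics_below \<alpha>" using s by (auto simp: dyadics_below_def dyadic_rats_iff)
  }
qed

lemma solovay_le_imp_bounded:
  assumes S: "\<beta> \<le>\<^sub>S \<alpha>" and a: "left_ce_approx a \<alpha>"
  obtains b and N :: nat where "left_ce_approx b \<beta>"
    "\<And>s. \<beta> - real_of_rat (b s) \<le> N * (\<alpha> - real_of_rat (a s))"
proof -
  obtain \<phi> and N :: nat where \<phi>: "partial_computable rat_encode rat_encode \<phi>"
      "dom \<phi> = dyadics_below \<alpha>" "ran \<phi> \<subseteq> dyadics_below \<beta>"
    and N: "\<And>q. q \<in> dyadics_below \<alpha> \<Longrightarrow>
      \<beta> - real_of_rat (the (\<phi> q)) < real N * (\<alpha> - real_of_rat q)"
    using S unfolding solovay_le_def by blast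
  obtain q where q: "rec_rat q" "\<And>s. q s \<in> dyadics_below \<alpha>" "\<And>s. a s \<le> q s"
    using dyadic_approx_above[OF a] by blast
  define v where "v s = the (\<phi> (q s))" for s
  have \<phi>v: "\<phi> (q s) = Some (v s)" for s using q(2)[of s] \<phi>(2) by (metis domD option.sel v_def)
  have v: "v s \<in> dyadics_below \<beta>" for s using \<phi>v[of s] \<phi>(3) by (auto intro: ranI)
  have v_rec: "rec_rat v"
  proof -
    obtain g where g: "partrec g" "\<And>x. g (rat_encode x) = map_option rat_encode (\<phi> x)"
      using \<phi>(1) by (auto simp: partial_computable_def)
    have "partrec (g \<circ>\<^sub>m (\<lambda>s. Some (rat_encode (q s))))"
      using g(1) q(1) by (auto simp: rec_rat_def total_rec_def intro: partrec.comp)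
    moreover have "g \<circ>\<^sub>m (\<lambda>s. Some (rat_encode (q s))) = (\<lambda>s. Some (rat_encode (v s)))"
      by (auto simp: map_comp_def g \<phi>v)
    ultimately show ?thesis by (simp add: rec_rat_def total_rec_def)
  qed
  \<comment> \<open>The values \<open>v\<close> need not be monotone, so their running maximum is
    used. It is taken via an index attaining it: each \<open>b s\<close> is then itself a value of
    the reduction, hence below \<beta>, and \<open>b\<close> is a composition of recursive
    functions.\<close>
  let ?P = "\<lambda>s i. i \<le> s \<and> (\<forall>j<Suc s. v j \<le> v i)"
  have ex: "\<exists>i. ?P s i" for s
  proof -
    have "Max (v ` {..s}) \<in> v ` {..s}" by (rule Max_in) auto
    then obtain i where i: "i \<le> s" "Max (v ` {..s}) = v i" by (metis atMost_iff imageE)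
    have "v j \<le> v i" if "j < Suc s" for j
      unfolding i(2)[symmetric] by (rule Max_ge) (use that in auto)
    with i(1) show ?thesis by blast
  qed
  define l where "l s = (LEAST i. ?P s i)" for s
  have l: "?P s (l s)" for s unfolding l_def using ex by (rule LeastI_ex)
  have "total_rec l"
    unfolding l_def by (intro rec_intros rec_rat_compose[OF v_rec] ex)
  define b where "b s = v (l s)" for s
  have b_below: "b s \<in> dyadics_below \<beta>" for s by (simp add: b_def v)
  have bound: "\<beta> - real_of_rat (b s) \<le> N * (\<alpha> - real_of_rat (a s))" for s
  proof -
    have "v s \<le> b s" using l[of s] by (simp add: b_def)
    then have "\<beta> - real_of_rat (b s) \<le> \<beta> - real_of_rat (v s)" by (simp add: of_rat_less_eq)
    also have "\<dots> \<le> N * (\<alpha> - real_of_rat (q s))" using N[OF q(2)] by (simp add: v_def less_imp_le)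
    also have "\<dots> \<le> N * (\<alpha> - real_of_rat (a s))"
      using q(3)[of s] by (intro mult_left_mono) (auto simp: of_rat_less_eq)
    finally show ?thesis .
  qed
  have "left_ce_approx b \<beta>"
    unfolding left_ce_approx_def
  proof (intro conjI allI)
    have "rec_rat b" unfolding b_def by (rule rec_rat_compose) fact+
    then show "computable id rat_encode b" by (simp add: computable_id_iff rec_rat_def)
    show "incseq b"
    proof (rule incseq_SucI)
      fix s
      have "l s < Suc (Suc s)" using l[of s] by simp
      then show "b s \<le> b (Suc s)" using l[of "Suc s"] by (simp add: b_def)
    qed
    show "0 \<le> b s" "real_of_rat (b s) < \<beta>" for s using b_below[of s] by (auto simp: dyadics_below_def)
    \<comment> \<open>Convergence comes from the bound itself, which squeezes \<open>b s\<close>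
      between this sequence and \<beta>.\<close>
    have "(\<lambda>s. \<beta> - N * (\<alpha> - real_of_rat (a s))) \<longlonglongrightarrow> \<beta> - N * (\<alpha> - \<alpha>)"
      using a by (intro tendsto_intros) (simp add: left_ce_approx_def)
    then have lim: "(\<lambda>s. \<beta> - N * (\<alpha> - real_of_rat (a s))) \<longlonglongrightarrow> \<beta>" by simp
    show "(\<lambda>s. real_of_rat (b s)) \<longlonglongrightarrow> \<beta>"
    proof (rule tendsto_sandwich[OF _ _ lim tendsto_const])
      show "\<forall>\<^sub>F s in sequentially. \<beta> - N * (\<alpha> - real_of_rat (a s)) \<le> real_of_rat (b s)"
        using bound by (simp add: algebra_simps)
      show "\<forall>\<^sub>F s in sequentially. real_of_rat (b s) \<le> \<beta>"
        using b_below by (simp add: dyadics_below_def less_imp_le)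
    qed
  qed
  then show ?thesis using bound by (rule that)
qed

lemma solovay_le_if_bounded:
  fixes N :: nat
  assumes a: "left_ce_approx a \<alpha>" and b: "left_ce_approx b \<beta>"
    and bound: "\<And>x. \<beta> - real_of_rat (b x) \<le> N * (\<alpha> - real_of_rat (a x))"
  shows "\<beta> \<le>\<^sub>S \<alpha>"
proof -
  obtain r where r: "rec_rat r" "\<And>s. r s \<in> dyadics_below \<beta>" "\<And>s. b s \<le> r s"
    using dyadic_approx_above[OF b] by blast
  let ?P = "\<lambda>q s. 0 \<le> q \<and> q \<le> a s \<and> snd (quotient_of q) dvd 2 ^ s"
  \<comment> \<open>The search has to run on numbers, so \<open>?P\<close> is restated for codes,
    whose second component is the denominator.\<close>
  let ?Q = "\<lambda>c s. 0 \<le> rat_decode c \<and> rat_decode c \<le> a s \<and> psnd c dvd 2 ^ s"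
  have Q: "?Q (rat_encode q) s \<longleftrightarrow> ?P q s" for q s
  proof -
    obtain i j where ij: "quotient_of q = (i, j)" by fastforce
    then have "j > 0" by (rule quotient_of_denom_pos)
    then have "nat j dvd 2 ^ s \<longleftrightarrow> j dvd 2 ^ s"
      by (metis int_nat_eq of_nat_dvd_iff of_nat_numeral of_nat_power less_imp_le)
    then show ?thesis by (simp add: rat_encode_def[of q] ij rat_decode_encode[of q, unfolded rat_encode_def ij, simplified])
  qed
  define s where "s q = (LEAST s. ?P q s)" for q
  define \<phi> where "\<phi> q = (if q \<in> dyadics_below \<alpha> then Some (r (s q)) else None)" for q
  have "partrec (\<lambda>c. if \<exists>s. ?Q c s then Some (LEAST s. ?Q c s) else None)"
    by (intro partrec_Least rec_intros left_ce_approx_rec[OF a])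
  moreover have "partrec (\<lambda>n. Some (rat_encode (r n)))"
    using r(1) by (simp add: rec_rat_def total_rec_def)
  ultimately have "partrec ((\<lambda>n. Some (rat_encode (r n)))
      \<circ>\<^sub>m (\<lambda>c. if \<exists>s. ?Q c s then Some (LEAST s. ?Q c s) else None))"
    by (rule partrec.comp[rotated])
  moreover have "((\<lambda>n. Some (rat_encode (r n)))
      \<circ>\<^sub>m (\<lambda>c. if \<exists>s. ?Q c s then Some (LEAST s. ?Q c s) else None)) (rat_encode q)
      = map_option rat_encode (\<phi> q)" for q
    unfolding map_comp_def Q by (simp add: \<phi>_def s_def dyadics_below_iff[OF a])
  ultimately have "partial_computable rat_encode rat_encode \<phi>"
    unfolding partial_computable_def by blast
  moreover have "dom \<phi> = dyadics_below \<alpha>" by (auto simp: \<phi>_def dom_def)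
  moreover have "ran \<phi> \<subseteq> dyadics_below \<beta>" using r(2) by (auto simp: \<phi>_def ran_def)
  \<comment> \<open>Passing to \<open>Suc N\<close> makes the inequality strict, since
    \<open>q\<close> is strictly below \<alpha>.\<close>
  moreover have "\<beta> - real_of_rat (the (\<phi> q)) < real (Suc N) * (\<alpha> - real_of_rat q)"
    if q: "q \<in> dyadics_below \<alpha>" for q
  proof -
    have "?P q (s q)"
      unfolding s_def using q unfolding dyadics_below_iff[OF a] by (rule LeastI_ex)
    have "\<beta> - real_of_rat (the (\<phi> q)) \<le> \<beta> - real_of_rat (b (s q))"
      using q r(3)[of "s q"] by (simp add: \<phi>_def of_rat_less_eq)
    also have "\<dots> \<le> N * (\<alpha> - real_of_rat (a (s q)))" by (rule bound)
    also have "\<dots> \<le> N * (\<alpha> - real_of_rat q)"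
      using \<open>?P q (s q)\<close> by (intro mult_left_mono) (auto simp: of_rat_less_eq)
    also have "\<dots> < Suc N * (\<alpha> - real_of_rat q)"
      using q by (simp add: dyadics_below_def)
    finally show ?thesis .
  qed
  ultimately show ?thesis unfolding solovay_le_def by blast
qed

section \<open>Course-of-values recursion\<close>

lemma total_rec_binary:
  "total_rec (\<lambda>w. h (pfst w) (psnd w)) \<Longrightarrow> total_rec f \<Longrightarrow> total_rec g \<Longrightarrow> total_rec (\<lambda>n. h (f n) (g n))"
  using total_rec_compose[of "\<lambda>w. h (pfst w) (psnd w)" "\<lambda>n. prod_encode (f n, g n)"]
  by (simp add: rec_intros)

text \<open>A history of length \<open>s\<close> is a nested pair with the newest value outermost,
  so the value at \<open>u\<close> lies under \<open>s - Suc u\<close> others.\<close>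

definition lookup :: "nat \<Rightarrow> nat \<Rightarrow> nat \<Rightarrow> nat" where
  "lookup h s u = pfst ((psnd ^^ (s - Suc u)) h)"

lemma total_rec_lookup [rec_intros]:
  assumes "total_rec f" "total_rec g" "total_rec h"
  shows "total_rec (\<lambda>n. lookup (f n) (g n) (h n))"
proof -
  have "(psnd ^^ s) c = rec_nat c (\<lambda>_. psnd) s" for s c by (induction s) auto
  then show ?thesis unfolding lookup_def by (simp add: rec_intros assms)
qed

text \<open>The history is built by primitive recursion. By \<open>cong\<close>, \<open>G\<close> at
  \<open>s\<close> reads its argument only below \<open>s\<close>, where looking up the history
  gives the values of \<open>H\<close>.\<close>

lemma course_of_values_recursion:
  assumes G: "total_rec (\<lambda>z. G (lookup (psnd z) (pfst z)) (pfst z))"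
    and cong: "\<And>H H' s. (\<And>u. u < s \<Longrightarrow> H u = H' u) \<Longrightarrow> G H s = G H' s"
  obtains H where "total_rec H" "\<And>s. H s = G H s"
proof -
  define hist where "hist = rec_nat 0 (\<lambda>s h. prod_encode (G (lookup h s) s, h))"
  have hist: "hist (Suc s) = prod_encode (G (lookup (hist s) s) s, hist s)" for s
    by (simp add: hist_def)
  define H where "H s = pfst (hist (Suc s))" for s
  have drop: "(psnd ^^ k) (hist (k + j)) = hist j" for k j
    by (induction k) (simp_all add: hist funpow_Suc_right del: funpow.simps)
  have "lookup (hist s) s u = H u" if "u < s" for s u
    using drop[of "s - Suc u" "Suc u"] that by (simp add: lookup_def H_def)
  then have "H s = G H s" for s
    using cong[of s "lookup (hist s) s" H] by (simp add: H_def hist)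
  moreover have "total_rec (\<lambda>w. G (lookup (psnd (psnd w)) (pfst (psnd w))) (pfst (psnd w)))"
    using total_rec_compose[OF G, of psnd] by (simp add: rec_intros)
  then have "total_rec H"
    unfolding H_def hist_def by (intro rec_intros)
  ultimately show ?thesis using that by blast
qed

section \<open>The diagonal construction\<close>

text \<open>
  A history \<open>H\<close> records the actions taken so far: \<open>H u = 0\<close> if nothing happens at stage \<open>u\<close>, and
  \<open>H u = Suc (prod_encode (x, T))\<close> if membership of \<open>x\<close> is switched because of the \<open>T\<close>-th set of
  the approximation under attack. Stage \<open>u\<close> is reserved for requirement \<open>pfst u\<close>, and requirement
  \<open>e\<close> tries to make the cost of the approximation computed by program \<open>pfst e\<close> at least \<open>e\<close>,
  up to a constant; as every program occurs in arbitrarily large \<open>e\<close>, this makes its cost infinite.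
\<close>

abbreviation witness :: "(nat \<Rightarrow> nat) \<Rightarrow> nat \<Rightarrow> nat" where "witness H u \<equiv> pfst (H u - 1)"
abbreviation index :: "(nat \<Rightarrow> nat) \<Rightarrow> nat \<Rightarrow> nat" where "index H u \<equiv> psnd (H u - 1)"

text \<open>Membership starts out false and every action on \<open>y\<close> switches it, hence the
  parity.\<close>

definition member :: "(nat \<Rightarrow> nat) \<Rightarrow> nat \<Rightarrow> nat \<Rightarrow> bool" where
  "member H s y \<longleftrightarrow> odd (\<Sum>u<s. of_bool (H u \<noteq> 0 \<and> witness H u = y) :: nat)"

text \<open>Smaller requirement numbers have priority. The value is one more than the stage of the
  last action with priority over \<open>e\<close>, or 0 if there is none.\<close>

definition last_injury :: "(nat \<Rightarrow> nat) \<Rightarrow> nat \<Rightarrow> nat \<Rightarrow> nat" where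
  "last_injury H e = rec_nat 0 (\<lambda>u r. if H u \<noteq> 0 \<and> pfst u < e then Suc u else r)"

text \<open>The number of consecutive sets, from the 0th on, that the opponent has delivered within
  \<open>s\<close> steps, capped at \<open>s\<close>; the newest of them has index
  \<open>halted e s - 1\<close>.\<close>

definition halted :: "nat \<Rightarrow> nat \<Rightarrow> nat" where
  "halted e s = (LEAST t. t = s \<or> sim (pfst e) t s = 0)"

definition approx :: "nat \<Rightarrow> nat \<Rightarrow> nat \<Rightarrow> nat set" where
  "approx e s v = set_decode (sim (pfst e) v s - 1)"

lemma total_rec_last_injury [rec_intros]:
  assumes "total_rec (\<lambda>w. H (pfst w) (psnd w))" "total_rec e" "total_rec s"
  shows "total_rec (\<lambda>n. last_injury (H n) (e n) (s n))"
  unfolding last_injury_def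
  by (intro rec_intros assms total_rec_binary[OF assms(1)] total_rec_compose[OF assms(2)])

lemma rec_pred_member [rec_intros]:
  assumes "total_rec (\<lambda>w. H (pfst w) (psnd w))" "total_rec s" "total_rec y"
  shows "rec_pred (\<lambda>n. member (H n) (s n) (y n))"
  unfolding member_def even_iff_mod_2_eq_zero
  by (intro rec_intros assms total_rec_binary[OF assms(1)] total_rec_compose[OF assms(3)])

lemma total_rec_halted [rec_intros]:
  assumes "total_rec e" "total_rec s" shows "total_rec (\<lambda>n. halted (e n) (s n))"
  unfolding halted_def
  by (intro rec_intros total_rec_compose[OF assms(1)] total_rec_compose[OF assms(2)]) blast

lemma rec_pred_approx [rec_intros]:
  assumes "total_rec e" "total_rec s" "total_rec v" "total_rec y"
  shows "rec_pred (\<lambda>n. y n \<in> approx (e n) (s n) (v n))"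
  unfolding approx_def set_decode_def mem_Collect_eq even_iff_mod_2_eq_zero
  by (intro rec_intros assms)

section \<open>Stabilisation of injuries and of the delivered sets\<close>

lemma last_injury_Suc:
  "last_injury H e (Suc s) = (if H s \<noteq> 0 \<and> pfst s < e then Suc s else last_injury H e s)"
  by (simp add: last_injury_def)

lemma last_injury_0 [simp]: "last_injury H e 0 = 0"
  by (simp add: last_injury_def)

lemma last_injury_le: "last_injury H e s \<le> s"
  by (induction s) (auto simp: last_injury_Suc)

lemma last_injury_greater: "H u \<noteq> 0 \<Longrightarrow> pfst u < e \<Longrightarrow> u < s \<Longrightarrow> u < last_injury H e s"
  by (induction s) (auto simp: last_injury_Suc less_Suc_eq)

lemma last_injury_idem: "last_injury H e (last_injury H e s) = last_injury H e s"
  by (induction s) (auto simp: last_injury_Suc)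

lemma last_injury_stable:
  assumes "finite {u. H u \<noteq> 0 \<and> pfst u < e}"
  obtains l where "\<And>s. l \<le> s \<Longrightarrow> last_injury H e s = l"
    "\<And>u. l \<le> u \<Longrightarrow> H u \<noteq> 0 \<Longrightarrow> e \<le> pfst u"
proof -
  obtain k where k: "\<And>u. H u \<noteq> 0 \<Longrightarrow> pfst u < e \<Longrightarrow> u < k"
    using assms by (auto simp: finite_nat_set_iff_bounded)
  let ?l = "last_injury H e k"
  have 1: "e \<le> pfst u" if "?l \<le> u" "H u \<noteq> 0" for u
    using k[of u] last_injury_greater[of H u e k] that by (meson not_less)
  \<comment> \<open>Idempotence gives the value already at stage \<open>?l\<close> itself, and no
    injury occurs from there on.\<close>
  have "last_injury H e s = ?l" if "?l \<le> s" for s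
    using that
  proof (induction s rule: dec_induct)
    case base
    show ?case by (rule last_injury_idem)
  next
    case (step s)
    then show ?case using 1[of s] by (auto simp: last_injury_Suc)
  qed
  then show ?thesis using 1 that by blast
qed

lemma last_injury_cong: "(\<And>u. u < s \<Longrightarrow> H u = H' u) \<Longrightarrow> last_injury H e s = last_injury H' e s"
  by (induction s) (auto simp: last_injury_Suc)

lemma member_cong: "(\<And>u. u < s \<Longrightarrow> H u = H' u) \<Longrightarrow> member H s y = member H' s y"
  unfolding member_def by (intro arg_cong[where f = odd] sum.cong) auto

lemma member_Suc: "member H (Suc s) y \<longleftrightarrow> (member H s y \<noteq> (H s \<noteq> 0 \<and> witness H s = y))"
  by (auto simp: member_def)

lemma halted_le: "halted e s \<le> s"
  unfolding halted_def by (rule Least_le) simp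

lemma halted_sim: "v < halted e s \<Longrightarrow> sim (pfst e) v s \<noteq> 0"
  unfolding halted_def using not_less_Least by blast

lemma sim_stable': "sim p x s \<noteq> 0 \<Longrightarrow> s \<le> s' \<Longrightarrow> sim p x s' = sim p x s"
  using sim_stable by (metis not0_implies_Suc)

lemma halted_mono: assumes "s \<le> s'" shows "halted e s \<le> halted e s'"
proof (rule ccontr)
  assume *: "\<not> ?thesis"
  have "halted e s' = s' \<or> sim (pfst e) (halted e s') s' = 0"
    unfolding halted_def by (rule LeastI[of _ s']) simp
  moreover have "sim (pfst e) (halted e s') s \<noteq> 0" using * by (intro halted_sim) simp
  ultimately show False
    using * assms sim_stable'[of "pfst e" "halted e s'" s s'] halted_le[of e s] by auto
qed

lemma approx_stable: "v < halted e s \<Longrightarrow> s \<le> s' \<Longrightarrow> approx e s' v = approx e s v"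
  using sim_stable'[OF halted_sim, of v e s s'] by (simp add: approx_def)

text \<open>The bound fails for every factor, and beyond every \<open>l\<close>, as witnesses have
  to lie beyond the last injury. \<open>B\<close> bounds the gain of any single action and, being
  positive, keeps \<open>factor\<close> nonzero.\<close>

locale unbounded_ratio =
  fixes a b :: "nat \<Rightarrow> rat" and \<alpha> \<beta> :: real and B :: nat
  assumes a: "left_ce_approx a \<alpha>" and b: "left_ce_approx b \<beta>"
    and B: "0 < B" "\<beta> \<le> B"
    and ratio: "\<And>(N::nat) l. \<exists>x\<ge>l. N * (\<alpha> - real_of_rat (a x)) < \<beta> - real_of_rat (b x)"
begin

text \<open>A lower bound for what the opponent pays for following the switch made at stage
  \<open>u\<close>, since it can react only after its set with index
  \<open>index H u\<close>.\<close>

definition gain :: "(nat \<Rightarrow> nat) \<Rightarrow> nat \<Rightarrow> rat" where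
  "gain H u = b (index H u) - b (witness H u)"

text \<open>Only actions of \<open>e\<close> within the injury period \<open>l\<close> count; an
  injury starts the account anew.\<close>

definition total_gain :: "(nat \<Rightarrow> nat) \<Rightarrow> nat \<Rightarrow> nat \<Rightarrow> nat \<Rightarrow> rat" where
  "total_gain H e l s =
     (\<Sum>u<s. if H u \<noteq> 0 \<and> pfst u = e \<and> last_injury H e u = l then gain H u else 0)"

text \<open>The gain of \<open>e\<close> within period \<open>l\<close> never exceeds
  \<open>e + B\<close>, so the cost of its actions there is at most \<open>1 / 2 ^ (e + l)\<close>,
  which is summable over \<open>e\<close> and \<open>l\<close>.\<close>

definition factor :: "nat \<Rightarrow> nat \<Rightarrow> nat" where
  "factor e l = (e + B) * 2 ^ (e + l)"

text \<open>
  Requirement \<open>e\<close> may switch \<open>x\<close> only if this costs little compared to what the opponent has to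
  pay for following suit, and only after the opponent has reacted to the previous switch.
  The latter holds because the previous witness is below \<open>last_injury H (Suc e) s\<close>.
\<close>

definition eligible :: "(nat \<Rightarrow> nat) \<Rightarrow> nat \<Rightarrow> nat \<Rightarrow> bool" where
  "eligible H s x \<longleftrightarrow>
     (let e = pfst s; l = last_injury H e s; t = halted e s in
      l \<le> x \<and> x < t \<and> total_gain H e l s < of_nat e \<and>
      of_nat (factor e l) * (a (Suc s) - a x) < b (t - 1) - b x \<and>
      (\<forall>y<max (Suc x) (last_injury H (Suc e) s). y \<in> approx e s (t - 1) \<longleftrightarrow> member H s y))"

text \<open>The alternative \<open>x = s\<close> stands for finding nothing; eligible numbers are
  below \<open>halted (pfst s) s\<close>, hence below \<open>s\<close>.\<close>

definition action :: "(nat \<Rightarrow> nat) \<Rightarrow> nat \<Rightarrow> nat" where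
  "action H s = (let x = LEAST x. x = s \<or> eligible H s x in
     if x = s then 0 else Suc (prod_encode (x, halted (pfst s) s - 1)))"

lemma rec_rat_total_gain [rec_intros]:
  assumes "total_rec (\<lambda>w. H (pfst w) (psnd w))" "total_rec e" "total_rec l" "total_rec s"
  shows "rec_rat (\<lambda>n. total_gain (H n) (e n) (l n) (s n))"
  unfolding total_gain_def gain_def
  by (intro rec_intros assms total_rec_binary[OF assms(1)] total_rec_compose[OF assms(2)]
      total_rec_compose[OF assms(3)] left_ce_approx_rec[OF b])

lemma rec_pred_eligible [rec_intros]:
  assumes "total_rec (\<lambda>w. H (pfst w) (psnd w))" "total_rec s" "total_rec x"
  shows "rec_pred (\<lambda>n. eligible (H n) (s n) (x n))"
  unfolding eligible_def factor_def Let_def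
  by (intro rec_intros assms total_rec_binary[OF assms(1)] total_rec_compose[OF assms(2)]
      total_rec_compose[OF assms(3)] left_ce_approx_rec[OF b] left_ce_approx_rec[OF a])

lemma total_rec_action [rec_intros]:
  assumes "total_rec (\<lambda>w. H (pfst w) (psnd w))" "total_rec s"
  shows "total_rec (\<lambda>n. action (H n) (s n))"
  unfolding action_def Let_def
  by (intro rec_intros assms total_rec_binary[OF assms(1)] total_rec_compose[OF assms(2)]) blast+

lemma action_cong:
  assumes "\<And>u. u < s \<Longrightarrow> H u = H' u"
  shows "action H s = action H' s"
proof -
  have "total_gain H e l s = total_gain H' e l s" for e l
    unfolding total_gain_def
  proof (rule sum.cong[OF refl])
    fix u assume "u \<in> {..<s}"
    then have "last_injury H e u = last_injury H' e u" "H u = H' u"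
      using assms by (auto intro: last_injury_cong)
    then show "(if H u \<noteq> 0 \<and> pfst u = e \<and> last_injury H e u = l then gain H u else 0) =
        (if H' u \<noteq> 0 \<and> pfst u = e \<and> last_injury H' e u = l then gain H' u else 0)"
      by (simp add: gain_def)
  qed
  then have "eligible H s = eligible H' s"
    using member_cong[OF assms] last_injury_cong[OF assms] by (simp add: eligible_def fun_eq_iff)
  then show ?thesis by (simp add: action_def)
qed

end


locale diagonal = unbounded_ratio +
  fixes H :: "nat \<Rightarrow> nat"
  assumes H: "\<And>s. H s = action H s" and H_rec: "total_rec H"
begin

section \<open>What an action guarantees\<close>

abbreviation acts :: "nat \<Rightarrow> nat \<Rightarrow> bool" where
  "acts e s \<equiv> H s \<noteq> 0 \<and> pfst s = e"

abbreviation "wit \<equiv> witness H"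
abbreviation "idx \<equiv> index H"
abbreviation "injury \<equiv> last_injury H"
abbreviation "approximant s \<equiv> {y. member H s y}"

lemma acts_eligible:
  assumes "H s \<noteq> 0"
  shows "eligible H s (wit s)" "idx s = halted (pfst s) s - 1"
proof -
  let ?x = "LEAST x. x = s \<or> eligible H s x"
  have "?x = s \<or> eligible H s ?x" by (rule LeastI[of _ s]) simp
  moreover have "?x \<noteq> s" "H s = Suc (prod_encode (?x, halted (pfst s) s - 1))"
    using assms H[of s] by (auto simp: action_def Let_def split: if_splits)
  ultimately show "eligible H s (wit s)" "idx s = halted (pfst s) s - 1" by auto
qed

lemma eligible_acts:
  assumes "eligible H s x"
  shows "H s \<noteq> 0" "wit s \<le> x"
proof -
  let ?x = "LEAST x. x = s \<or> eligible H s x"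
  have le: "?x \<le> x" using assms by (intro Least_le) simp
  have "x < s" using assms halted_le[of "pfst s" s] by (auto simp: eligible_def Let_def)
  with le have "?x \<noteq> s" by simp
  then have "H s = Suc (prod_encode (?x, halted (pfst s) s - 1))"
    using H[of s] by (simp add: action_def Let_def)
  then show "H s \<noteq> 0" "wit s \<le> x" using le by auto
qed

lemma acts_facts:
  assumes "acts e s"
  shows "injury e s \<le> wit s" "wit s \<le> idx s" "idx s < halted e s" "wit s < s"
    "total_gain H e (injury e s) s < of_nat e"
    "of_nat (factor e (injury e s)) * (a (Suc s) - a (wit s)) < gain H s"
    "\<And>y. y < max (Suc (wit s)) (injury (Suc e) s) \<Longrightarrow> y \<in> approx e s (idx s) \<longleftrightarrow> member H s y"
  using acts_eligible[of s] assms halted_le[of e s]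
  by (auto simp: eligible_def Let_def gain_def)

lemma seq_mono: "m \<le> n \<Longrightarrow> a m \<le> a n" "m \<le> n \<Longrightarrow> b m \<le> b n"
  using a b by (auto simp: left_ce_approx_def dest: incseqD)

lemma gain_pos: assumes "H s \<noteq> 0" shows "0 < gain H s"
proof -
  have "wit s \<le> Suc s" using acts_facts(4)[of s "pfst s"] assms by simp
  then have "0 \<le> of_nat (factor (pfst s) (injury (pfst s) s)) * (a (Suc s) - a (wit s))"
    using seq_mono(1) by simp
  also have "\<dots> < gain H s" using acts_facts(6)[of s "pfst s"] assms by simp
  finally show ?thesis .
qed

lemma gain_le: "gain H s \<le> of_nat B"
proof -
  have "real_of_rat (b (idx s)) < B" using b B(2) by (auto simp: left_ce_approx_def intro: less_le_trans)
  then have "real_of_rat (b (idx s)) < real_of_rat (of_nat B)" by simp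
  then have "b (idx s) < of_nat B" by (simp only: of_rat_less)
  moreover have "0 \<le> b (wit s)" using b by (simp add: left_ce_approx_def)
  ultimately show ?thesis by (simp add: gain_def)
qed

section \<open>The cost of the constructed approximation\<close>

lemma total_gain_Suc:
  "total_gain H e l (Suc s) = total_gain H e l s + (if acts e s \<and> injury e s = l then gain H s else 0)"
  by (simp add: total_gain_def)

text \<open>An action requires a total below \<open>e\<close> beforehand and adds at most
  \<open>B\<close>.\<close>

lemma total_gain_le: "total_gain H e l s \<le> of_nat (e + B)"
proof (induction s)
  case (Suc s)
  show ?case
  proof (cases "acts e s \<and> injury e s = l")
    case True
    then have "total_gain H e l s < of_nat e" using acts_facts(5)[of s e] by auto
    then show ?thesis using gain_le[of s] True by (simp add: total_gain_Suc)
  next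
    case False
    then show ?thesis using Suc by (auto simp: total_gain_Suc)
  qed
qed (simp add: total_gain_def)

lemma stage_cost_approximant:
  "stage_cost (seq_cost a) approximant (Suc s) = (if H s \<noteq> 0 then a (Suc s) - a (wit s) else 0)"
proof (cases "H s = 0")
  case True
  then show ?thesis by (simp add: stage_cost_def member_Suc)
next
  case False
  then have w: "wit s < s" using acts_facts(4)[of s "pfst s"] by simp
  have "(x \<in> approximant s) \<noteq> (x \<in> approximant (Suc s)) \<longleftrightarrow> x = wit s" for x
    using False by (auto simp: member_Suc)
  then have "stage_cost (seq_cost a) approximant (Suc s) = seq_cost a (wit s) (Suc s)"
    using w by (auto simp: stage_cost_def less_SucI intro!: arg_cong2[where f = "seq_cost a"] Least_equality)
  then show ?thesis using w False by (simp add: seq_cost_def)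
qed

lemma stage_cost_le:
  assumes "H s \<noteq> 0"
  shows "a (Suc s) - a (wit s) \<le> gain H s / of_nat (factor (pfst s) (injury (pfst s) s))"
proof -
  have pos: "0 < (of_nat (factor (pfst s) (injury (pfst s) s)) :: rat)"
    using B(1) by (simp add: factor_def add_nonneg_pos)
  show ?thesis
    using acts_facts(6)[of s "pfst s"] assms by (simp add: pos_le_divide_eq[OF pos] mult.commute less_imp_le)
qed

lemma sum_half_powers: "(\<Sum>i<n. (1/2::rat) ^ i) \<le> 2"
proof -
  have "(\<Sum>i<n. (1/2::rat) ^ i) = 2 - 2 * (1/2) ^ n" by (induction n) auto
  then show ?thesis by simp
qed

lemma sum_cost_le: "(\<Sum>s<n. stage_cost (seq_cost a) approximant (Suc s)) \<le> 4"
proof -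
  \<comment> \<open>Costs are sorted by requirement and injury period. An action at stage
    \<open>s\<close> belongs to exactly one such pair, and both of its entries are at most
    \<open>s\<close>.\<close>
  let ?g = "\<lambda>e l s. if acts e s \<and> injury e s = l then gain H s / of_nat (factor e l) else 0"
  have "(\<Sum>s<n. stage_cost (seq_cost a) approximant (Suc s)) \<le> (\<Sum>s<n. \<Sum>e<n. \<Sum>l<n. ?g e l s)"
  proof (rule sum_mono)
    fix s assume s: "s \<in> {..<n}"
    have nn: "0 \<le> ?g e l s" for e l
      using gain_pos[of s] by (simp add: less_imp_le)
    show "stage_cost (seq_cost a) approximant (Suc s) \<le> (\<Sum>e<n. \<Sum>l<n. ?g e l s)"
    proof (cases "H s = 0")
      case True
      then show ?thesis by (simp add: stage_cost_approximant)
    next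
      case False
      have "pfst s \<le> s" using le_prod_encode_1[of "pfst s" "psnd s"] by simp
      then have e: "pfst s \<in> {..<n}" using s by simp
      have l: "injury (pfst s) s \<in> {..<n}" using last_injury_le[of H "pfst s" s] s by simp
      have "stage_cost (seq_cost a) approximant (Suc s) \<le> ?g (pfst s) (injury (pfst s) s) s"
        using False stage_cost_le[of s] by (simp add: stage_cost_approximant)
      also have "\<dots> \<le> (\<Sum>l<n. ?g (pfst s) l s)" using l by (intro member_le_sum nn) auto
      also have "\<dots> \<le> (\<Sum>e<n. \<Sum>l<n. ?g e l s)"
        by (rule member_le_sum[OF e, of "\<lambda>e. \<Sum>l<n. ?g e l s"]) (auto intro: sum_nonneg nn)
      finally show ?thesis .
    qed
  qed
  also have "\<dots> = (\<Sum>e<n. \<Sum>l<n. \<Sum>s<n. ?g e l s)"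
    by (subst sum.swap) (intro sum.cong refl sum.swap)
  also have "\<dots> \<le> (\<Sum>e<n. \<Sum>l<n. (1/2) ^ e * (1/2) ^ l)"
  proof (intro sum_mono)
    fix e l
    have "(\<Sum>s<n. ?g e l s) = total_gain H e l n / of_nat (factor e l)"
      unfolding total_gain_def sum_divide_distrib by (intro sum.cong) auto
    also have "\<dots> \<le> of_nat (e + B) / of_nat (factor e l)"
      by (intro divide_right_mono total_gain_le) simp
    also have "\<dots> = (1/2) ^ e * (1/2) ^ l"
    proof -
      have "(of_nat (e + B) :: rat) \<noteq> 0" using B(1) by (subst of_nat_eq_0_iff) simp
      moreover have "(of_nat (factor e l) :: rat) = of_nat (e + B) * (2 ^ e * 2 ^ l)"
        by (simp only: factor_def of_nat_mult of_nat_power of_nat_numeral power_add)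
      ultimately show ?thesis by (simp add: power_one_over del: of_nat_add)
    qed
    finally show "(\<Sum>s<n. ?g e l s) \<le> (1/2) ^ e * (1/2) ^ l" .
  qed
  also have "\<dots> = (\<Sum>e<n. (1/2) ^ e) * (\<Sum>l<n. (1/2) ^ l)"
    by (simp add: sum_product)
  also have "\<dots> \<le> 2 * 2"
    by (intro mult_mono sum_half_powers) (auto intro: sum_nonneg)
  finally show ?thesis by simp
qed

section \<open>Finite injury\<close>

definition last_injury_at :: "nat \<Rightarrow> nat \<Rightarrow> bool" where
  "last_injury_at e l \<longleftrightarrow> (\<forall>s\<ge>l. injury e s = l) \<and> (\<forall>u\<ge>l. H u \<noteq> 0 \<longrightarrow> e \<le> pfst u)"

lemma last_injury_atD:
  assumes "last_injury_at e l"
  shows "l \<le> s \<Longrightarrow> injury e s = l" "l \<le> s \<Longrightarrow> H s \<noteq> 0 \<Longrightarrow> e \<le> pfst s"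
  using assms by (auto simp: last_injury_at_def)

context
  fixes e l
  assumes stable: "last_injury_at e l"
begin

lemmas injury = last_injury_atD(1)[OF stable]
lemmas no_injury = last_injury_atD(2)[OF stable]

text \<open>
  Requirements above \<open>e\<close> use witnesses beyond the last action of \<open>e\<close>, so the switched witness
  keeps its value until the next action of \<open>e\<close>, which needs agreement on it.
\<close>

lemma consecutive_acts:
  assumes "l \<le> u" "u < s" "acts e u" "acts e s" and between: "\<And>v. u < v \<Longrightarrow> v < s \<Longrightarrow> \<not> acts e v"
  shows "idx u < idx s" "(wit u \<in> approx e s (idx u)) \<noteq> (wit u \<in> approx e s (idx s))"
proof -
  let ?x = "wit u"
  have inj: "u < injury (Suc e) s" using assms by (intro last_injury_greater) auto
  have x: "?x < u" using acts_facts(4)[OF assms(3)] .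
  have "Suc u \<le> v \<Longrightarrow> v \<le> s \<Longrightarrow> member H v ?x \<longleftrightarrow> \<not> member H u ?x" for v
  proof (induction v rule: dec_induct)
    case base
    then show ?case using assms(3) by (simp add: member_Suc)
  next
    case (step v)
    have "\<not> (H v \<noteq> 0 \<and> wit v = ?x)"
    proof
      assume v: "H v \<noteq> 0 \<and> wit v = ?x"
      then have "e < pfst v"
        using no_injury[of v] between[of v] step assms(1) by (auto simp: order_le_less)
      then have "u < injury (pfst v) v" using step assms(3) by (intro last_injury_greater) auto
      also have "\<dots> \<le> wit v" using acts_facts(1)[of v "pfst v"] v by simp
      finally show False using v x by simp
    qed
    then show ?case using step by (simp add: member_Suc)
  qed
  then have "member H s ?x \<longleftrightarrow> \<not> member H u ?x" using assms(2) by simp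
  moreover have "?x \<in> approx e s (idx s) \<longleftrightarrow> member H s ?x"
    using inj x by (intro acts_facts(7)[OF assms(4)]) auto
  moreover have "?x \<in> approx e u (idx u) \<longleftrightarrow> member H u ?x"
    by (intro acts_facts(7)[OF assms(3)]) auto
  moreover have "approx e s (idx u) = approx e u (idx u)"
    using acts_facts(3)[OF assms(3)] assms(2) by (intro approx_stable) auto
  ultimately show neq: "(?x \<in> approx e s (idx u)) \<noteq> (?x \<in> approx e s (idx s))" by simp
  have "idx u \<le> idx s"
    using acts_eligible(2)[of u] acts_eligible(2)[of s] assms(2-4) halted_mono[of u s e]
    by (simp add: diff_le_mono)
  moreover have "idx u \<noteq> idx s" using neq by auto
  ultimately show "idx u < idx s" by simp
qed

lemma last_act:
  assumes "l \<le> u" "u < s" "acts e u"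
  obtains v where "u \<le> v" "v < s" "acts e v" "\<And>w. v < w \<Longrightarrow> w < s \<Longrightarrow> \<not> acts e w"
proof -
  let ?S = "{v. u \<le> v \<and> v < s \<and> acts e v}"
  have fin: "finite ?S" by (rule finite_subset[of _ "{..<s}"]) auto
  have "u \<in> ?S" using assms by simp
  then have "Max ?S \<in> ?S" using fin by (intro Max_in) auto
  moreover have "\<not> acts e w" if "Max ?S < w" "w < s" for w
  proof
    assume "acts e w"
    then have "w \<in> ?S" using that \<open>Max ?S \<in> ?S\<close> by simp
    from Max_ge[OF fin this] that show False by simp
  qed
  ultimately show ?thesis using that by blast
qed

text \<open>The step from the last action before \<open>s\<close> is strict because the opponent
  must have delivered a changed set; up to that action, monotonicity of \<open>halted\<close>
  suffices.\<close>

lemma idx_strict_mono: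
  assumes "l \<le> u" "u < s" "acts e u" "acts e s"
  shows "idx u < idx s"
proof -
  obtain v where v: "u \<le> v" "v < s" "acts e v" "\<And>w. v < w \<Longrightarrow> w < s \<Longrightarrow> \<not> acts e w"
    using last_act[OF assms(1-3)] by blast
  have "idx u \<le> idx v"
    using acts_eligible(2)[of u] acts_eligible(2)[of v] assms v halted_mono[of u v e]
    by (simp add: diff_le_mono)
  also have "\<dots> < idx s" using consecutive_acts(1)[of v s] v assms by simp
  finally show ?thesis .
qed

text \<open>\<open>ratio\<close> is applied with \<open>factor e l\<close>. As \<open>b t\<close>
  tends to \<beta>, the inequality holds from some \<open>T\<close> on, even with \<alpha> in place
  of \<open>a s\<close>, hence uniformly in \<open>s\<close>. The case \<open>s = x\<close> shows
  that \<open>b T - b x\<close> is positive.\<close>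

lemma good_witness:
  obtains x T where "l \<le> x" "x < T" "b x < b T"
    "\<And>s t. T \<le> t \<Longrightarrow> of_nat (factor e l) * (a s - a x) < b t - b x"
proof -
  obtain x where x: "l \<le> x" "factor e l * (\<alpha> - real_of_rat (a x)) < \<beta> - real_of_rat (b x)"
    using ratio by blast
  have "(\<lambda>t. real_of_rat (b t) - real_of_rat (b x)) \<longlonglongrightarrow> \<beta> - real_of_rat (b x)"
    using b by (intro tendsto_intros) (simp add: left_ce_approx_def)
  from order_tendstoD(1)[OF this x(2)] obtain T where
    T: "\<And>t. T \<le> t \<Longrightarrow> factor e l * (\<alpha> - real_of_rat (a x)) < real_of_rat (b t) - real_of_rat (b x)"
    by (auto simp: eventually_sequentially)
  have *: "of_nat (factor e l) * (a s - a x) < b t - b x" if "T \<le> t" for s t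
  proof -
    have "real_of_rat (a s) \<le> \<alpha>" using a by (auto simp: left_ce_approx_def intro: less_imp_le)
    then have "factor e l * (real_of_rat (a s) - real_of_rat (a x)) \<le> factor e l * (\<alpha> - real_of_rat (a x))"
      by (intro mult_left_mono) auto
    also have "\<dots> < real_of_rat (b t) - real_of_rat (b x)" by (rule T[OF that])
    finally have "real_of_rat (of_nat (factor e l) * (a s - a x)) < real_of_rat (b t - b x)"
      by (simp add: of_rat_mult of_rat_diff)
    then show ?thesis by (simp only: of_rat_less)
  qed
  show ?thesis
  proof (rule that[of x "max T (Suc x)"])
    show "b x < b (max T (Suc x))" using *[of "max T (Suc x)" x] by simp
  qed (use x(1) * in auto)
qed

text \<open>Infinitely many actions have distinct indices, so infinitely many of them have index at
  least \<open>T\<close>. Each of these gains at least \<open>b T - b x\<close>, which pushes the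
  total beyond \<open>e\<close>, where acting is forbidden.\<close>

lemma finite_acts_above: "finite {s. l \<le> s \<and> acts e s}"
proof (rule ccontr)
  let ?S = "{s. l \<le> s \<and> acts e s}"
  assume inf: "infinite ?S"
  obtain x T where x: "l \<le> x" "x < T" "b x < b T"
    "\<And>s t. T \<le> t \<Longrightarrow> of_nat (factor e l) * (a s - a x) < b t - b x"
    using good_witness by blast
  have "inj_on idx ?S"
    by (rule linorder_inj_onI') (use idx_strict_mono in \<open>auto dest: less_imp_neq\<close>)
  then have "finite {s \<in> ?S. idx s < T}"
    by (rule_tac finite_imageD[of idx]) (auto intro: finite_subset[of _ "{..<T}"] inj_on_subset)
  moreover have "?S \<subseteq> {s \<in> ?S. idx s < T} \<union> {s \<in> ?S. T \<le> idx s}" by auto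
  ultimately have inf': "infinite {s \<in> ?S. T \<le> idx s}"
    using inf by (meson finite_UnI finite_subset)
  let ?\<eta> = "b T - b x"
  \<comment> \<open>If the witness were larger than \<open>x\<close>, then \<open>x\<close> would be
    eligible too, as the region of agreement only shrinks; the least choice excludes this.\<close>
  have gain: "?\<eta> \<le> gain H s" if s: "s \<in> ?S" "T \<le> idx s" for s
  proof -
    have act: "acts e s" and ls: "l \<le> s" using s by auto
    have "wit s \<le> x"
    proof (rule ccontr)
      assume less: "\<not> wit s \<le> x"
      have "eligible H s x"
        using act acts_facts(3,5,7)[OF act] less x s acts_eligible(2)[of s] injury[OF ls]
        by (auto simp: eligible_def Let_def)
      then show False using eligible_acts(2) less by blast
    qed
    then show ?thesis using seq_mono(2)[of "wit s" x] seq_mono(2)[OF s(2)] by (simp add: gain_def)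
  qed
  obtain n where n: "of_nat e < of_nat n * ?\<eta>"
    using ex_less_of_nat_mult[of ?\<eta>] x(3) by auto
  obtain F where F: "F \<subseteq> {s \<in> ?S. T \<le> idx s}" "card F = n" "finite F"
    using infinite_arbitrarily_large[OF inf'] by blast
  obtain s where s: "s \<in> ?S" "\<forall>u\<in>F. u < s"
  proof -
    obtain k where "\<forall>u\<in>F. u < k" using F(3) by (auto simp: finite_nat_set_iff_bounded)
    moreover obtain s where "\<not> s < k" "s \<in> ?S"
      using inf[unfolded finite_nat_set_iff_bounded] by blast
    ultimately show ?thesis using that by force
  qed
  have "of_nat n * ?\<eta> \<le> (\<Sum>u\<in>F. gain H u)"
    using F gain by (subst F(2)[symmetric]) (intro sum_bounded_below, auto)
  also have "\<dots> = (\<Sum>u\<in>F. if acts e u \<and> injury e u = l then gain H u else 0)"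
    using F(1) injury by (intro sum.cong) auto
  also have "\<dots> \<le> total_gain H e l s"
    unfolding total_gain_def conj_assoc[symmetric]
    by (intro sum_mono2) (use s(2) in \<open>auto intro: less_imp_le gain_pos\<close>)
  also have "\<dots> < of_nat e" using acts_facts(5)[of s e] s(1) injury[of s] by auto
  finally show False using n by simp
qed

end

text \<open>Induction on priority: once all smaller requirements have stopped acting,
  \<open>e\<close> is no longer injured and acts only finitely often.\<close>

lemma finite_acts: "finite {s. acts e s}"
proof (induction e rule: less_induct)
  case (less e)
  have "{u. H u \<noteq> 0 \<and> pfst u < e} = (\<Union>e'<e. {s. acts e' s})" by auto
  then have "finite {u. H u \<noteq> 0 \<and> pfst u < e}" using less by simp
  then obtain l where l: "last_injury_at e l"
    using last_injury_stable[of H e] unfolding last_injury_at_def by metis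
  have "finite ({s. l \<le> s \<and> acts e s} \<union> {..<l})" using finite_acts_above[OF l] by simp
  then show ?case by (rule rev_finite_subset) auto
qed

lemma last_injury_at_exists: "\<exists>l. last_injury_at e l"
proof -
  have "{u. H u \<noteq> 0 \<and> pfst u < e} = (\<Union>e'<e. {s. acts e' s})" by auto
  then have "finite {u. H u \<noteq> 0 \<and> pfst u < e}" using finite_acts by simp
  then show ?thesis using last_injury_stable[of H e] unfolding last_injury_at_def by metis
qed

text \<open>After some action on \<open>y\<close> at stage \<open>u\<close>, requirements larger
  than \<open>pfst u\<close> only use witnesses beyond \<open>u\<close>, hence beyond
  \<open>y\<close>. The others act finitely often.\<close>

lemma member_stable: "\<exists>c. \<forall>\<^sub>F s in sequentially. member H s y = c"
proof -
  have "finite {u. H u \<noteq> 0 \<and> wit u = y}"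
  proof (cases "\<exists>u. H u \<noteq> 0 \<and> wit u = y")
    case True
    then obtain u where u: "H u \<noteq> 0" "wit u = y" by blast
    have "{v. H v \<noteq> 0 \<and> wit v = y} \<subseteq> {..u} \<union> (\<Union>e\<le>pfst u. {s. acts e s})"
    proof
      fix v assume v: "v \<in> {v. H v \<noteq> 0 \<and> wit v = y}"
      have "pfst v \<le> pfst u" if "u < v"
      proof (rule ccontr)
        assume "\<not> pfst v \<le> pfst u"
        then have "u < injury (pfst v) v" using that u by (intro last_injury_greater) auto
        also have "\<dots> \<le> wit v" using acts_facts(1)[of v "pfst v"] v by simp
        finally show False using v u acts_facts(4)[of u "pfst u"] by simp
      qed
      then show "v \<in> {..u} \<union> (\<Union>e\<le>pfst u. {s. acts e s})" using v by force
    qed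
    then show ?thesis by (rule finite_subset) (intro finite_UnI finite_UN_I finite_acts finite_atMost)
  next
    case False
    then have "{u. H u \<noteq> 0 \<and> wit u = y} = {}" by blast
    then show ?thesis by (simp only: finite.emptyI)
  qed
  then obtain k where k: "\<And>u. H u \<noteq> 0 \<Longrightarrow> wit u = y \<Longrightarrow> u < k"
    by (auto simp: finite_nat_set_iff_bounded)
  have "member H s y = member H k y" if "k \<le> s" for s
    using that by (induction s rule: dec_induct) (use k in \<open>auto simp: member_Suc dest: leD\<close>)
  then show ?thesis unfolding eventually_sequentially by blast
qed

section \<open>The limit set and its position in the arithmetical hierarchy\<close>

definition diagonal_set :: "nat set" where
  "diagonal_set = {y. \<forall>\<^sub>F s in sequentially. member H s y}"

lemma eventually_member: "\<forall>\<^sub>F s in sequentially. member H s y \<longleftrightarrow> y \<in> diagonal_set"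
proof -
  obtain c where c: "\<forall>\<^sub>F s in sequentially. member H s y = c"
    using member_stable[of y] by blast
  then have "(\<forall>\<^sub>F s in sequentially. member H s y) \<longleftrightarrow> (\<forall>\<^sub>F s in sequentially. c)"
    by (rule eventually_subst)
  then have "y \<in> diagonal_set \<longleftrightarrow> c" by (simp add: diagonal_set_def)
  with c show ?thesis by simp
qed

lemma member_less: "member H s y \<Longrightarrow> y < s"
proof (induction s)
  case (Suc s)
  then show ?case using acts_facts(4)[of s "pfst s"] by (auto simp: member_Suc split: if_splits)
qed (simp add: member_def)

lemma rec_pred_member_H: "total_rec s \<Longrightarrow> total_rec y \<Longrightarrow> rec_pred (\<lambda>n. member H (s n) (y n))"
  by (intro rec_intros total_rec_compose[OF H_rec])

lemma computable_approx_diagonal: "computable_approx approximant diagonal_set"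
  unfolding computable_approx_def
proof (intro conjI allI)
  show fin: "finite (approximant s)" for s
    by (rule finite_subset[of _ "{..<s}"]) (auto dest: member_less)
  have "set_encode (approximant s) = (\<Sum>y<s. if member H s y then 2 ^ y else 0)" for s
    unfolding set_encode_def
    by (rule sum.mono_neutral_cong_left) (auto dest: member_less)
  moreover have "total_rec (\<lambda>s. \<Sum>y<s. if member H s y then 2 ^ y else 0)"
    by (intro rec_intros rec_pred_member_H)
  ultimately show "computable id set_encode approximant"
    by (simp add: computable_id_iff)
  show "\<forall>\<^sub>F s in sequentially. (y \<in> approximant s) = (y \<in> diagonal_set)" for y
    using eventually_member by simp
qed

lemma Delta02_diagonal: "Delta02 diagonal_set"
proof -
  \<comment> \<open>The set and its complement are treated together: having the value
    \<open>c\<close> in the limit means that some \<open>y\<close> exists such that the value is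
    \<open>c\<close> at all stages \<open>y + z\<close>.\<close>
  have *: "Sigma02 {y. y \<in> diagonal_set \<longleftrightarrow> c}" for c
    unfolding Sigma02_def
  proof (intro exI[of _ "\<lambda>(x, y, z). member H (y + z) x \<longleftrightarrow> c"] conjI allI)
    have "rec_pred (\<lambda>n. member H (pfst (psnd n) + psnd (psnd n)) (pfst n) \<longleftrightarrow> c)"
      by (intro rec_intros rec_pred_member_H)
    then show "computable (\<lambda>(x, y, z). prod_encode (x, prod_encode (y, z))) of_bool
        (\<lambda>(x, y, z). member H (y + z) x \<longleftrightarrow> c)"
      unfolding rec_pred_def by (rule computableI) auto
    fix x
    obtain k where k: "\<And>s. k \<le> s \<Longrightarrow> member H s x \<longleftrightarrow> x \<in> diagonal_set"
      using eventually_member[of x] by (auto simp: eventually_sequentially)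
    have "(\<forall>z. member H (y + z) x \<longleftrightarrow> c) \<Longrightarrow> x \<in> diagonal_set \<longleftrightarrow> c" for y
      using k[of "y + k"] by simp
    moreover have "(x \<in> diagonal_set \<longleftrightarrow> c) \<Longrightarrow> \<forall>z. member H (k + z) x \<longleftrightarrow> c"
      using k by simp
    ultimately show "x \<in> {y. y \<in> diagonal_set \<longleftrightarrow> c} \<longleftrightarrow>
        (\<exists>y. \<forall>z. case (x, y, z) of (x, y, z) \<Rightarrow> member H (y + z) x \<longleftrightarrow> c)"
      by auto
  qed
  have "- diagonal_set = {y. y \<in> diagonal_set \<longleftrightarrow> False}" by auto
  then show ?thesis using *[of True] *[of False] by (simp add: Delta02_def)
qed

section \<open>One cost function is obeyed, the other is not\<close>

lemma diagonal_obeys: "diagonal_set \<Turnstile>\<^sub>c seq_cost a"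
proof -
  have inc: "incseq a" using a by (simp add: left_ce_approx_def)
  have "summable (\<lambda>s. real_of_rat (stage_cost (seq_cost a) approximant (Suc s)))"
  proof (rule summableI_nonneg_bounded)
    fix n
    show "0 \<le> real_of_rat (stage_cost (seq_cost a) approximant (Suc n))"
      using stage_cost_nonneg[OF inc] by simp
    have "real_of_rat (\<Sum>s<n. stage_cost (seq_cost a) approximant (Suc s)) \<le> real_of_rat 4"
      using sum_cost_le by (simp only: of_rat_less_eq)
    then show "(\<Sum>s<n. real_of_rat (stage_cost (seq_cost a) approximant (Suc s))) \<le> 4"
      by (simp add: of_rat_sum)
  qed
  then show ?thesis using computable_approx_diagonal by (auto simp: obeys_def)
qed

text \<open>The summand \<open>B\<close> accounts for the last action, to which the opponent need not have reacted.\<close>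

lemma total_gain_le_cost:
  assumes l: "last_injury_at e l"
    and Bs: "\<And>s v. v < halted e s \<Longrightarrow> approx e s v = Bs v"
    and cost: "\<And>n. (\<Sum>t<n. stage_cost (seq_cost b) Bs (Suc t)) \<le> D"
    and s: "l \<le> s"
  shows "total_gain H e l s \<le> D + of_nat B"
proof -
  let ?F = "\<lambda>n. \<Sum>t<n. stage_cost (seq_cost b) Bs (Suc t)"
  have inc: "incseq b" using b by (simp add: left_ce_approx_def)
  have F0: "0 \<le> ?F n" for n by (intro sum_nonneg stage_cost_nonneg inc)
  \<comment> \<open>Invariant: the gains of all actions but the last one, \<open>u\<close>, have
    been paid for by the opponent up to its set with index \<open>idx u\<close>.\<close>
  have "total_gain H e l s = 0 \<or> (\<exists>u. l \<le> u \<and> u < s \<and> acts e u \<and>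
      (\<forall>w. u < w \<longrightarrow> w < s \<longrightarrow> \<not> acts e w) \<and> total_gain H e l s \<le> ?F (idx u) + gain H u)"
    using s
  proof (induction s rule: dec_induct)
    case base
    have "injury e u \<noteq> l" if "u < l" for u using last_injury_le[of H e u] that by simp
    then show ?case unfolding total_gain_def by (intro disjI1 sum.neutral) auto
  next
    case (step s)
    show ?case
    proof (cases "acts e s")
      case False
      then have eq: "total_gain H e l (Suc s) = total_gain H e l s"
        by (auto simp: total_gain_Suc)
      show ?thesis unfolding eq using step.IH False by (auto simp: less_Suc_eq)
    next
      case True
      then have eq: "total_gain H e l (Suc s) = total_gain H e l s + gain H s"
        using last_injury_atD(1)[OF l step.hyps(1)] by (simp add: total_gain_Suc)
      have "total_gain H e l s \<le> ?F (idx s)"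
        using step.IH
      proof
        assume "\<exists>u. l \<le> u \<and> u < s \<and> acts e u \<and>
          (\<forall>w. u < w \<longrightarrow> w < s \<longrightarrow> \<not> acts e w) \<and> total_gain H e l s \<le> ?F (idx u) + gain H u"
        then obtain u where u: "l \<le> u" "u < s" "acts e u" "\<And>w. u < w \<Longrightarrow> w < s \<Longrightarrow> \<not> acts e w"
          "total_gain H e l s \<le> ?F (idx u) + gain H u" by blast
        note c = consecutive_acts[OF l u(1,2,3) True u(4)]
        have lt: "idx u < idx s" using c(1) by simp
        have less: "idx s < halted e s" by (rule acts_facts(3)[OF True])
        \<comment> \<open>Between the two actions the opponent changed its mind on
          \<open>wit u\<close>, and this costs at least \<open>gain H u\<close>.\<close>
        have "(wit u \<in> Bs (idx u)) \<noteq> (wit u \<in> Bs (idx s))"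
          using c(2) Bs[of "idx u" s] Bs[of "idx s" s] lt less by simp
        then have "gain H u \<le> (\<Sum>t\<in>{idx u..<idx s}. stage_cost (seq_cost b) Bs (Suc t))"
          unfolding gain_def using lt acts_facts(2)[OF u(3)]
          by (intro sum_stage_cost_ge inc) auto
        moreover have "?F (idx s) = ?F (idx u) + (\<Sum>t\<in>{idx u..<idx s}. stage_cost (seq_cost b) Bs (Suc t))"
          using lt by (simp add: lessThan_atLeast0 sum.atLeastLessThan_concat)
        ultimately show ?thesis using u(5) by simp
      qed (simp add: F0)
      then show ?thesis
        unfolding eq using True step.hyps by (intro disjI2 exI[of _ s]) auto
    qed
  qed
  then show ?thesis
  proof
    assume "total_gain H e l s = 0"
    then show ?thesis using cost[of 0] by simp
  next
    assume "\<exists>u. l \<le> u \<and> u < s \<and> acts e u \<and>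
      (\<forall>w. u < w \<longrightarrow> w < s \<longrightarrow> \<not> acts e w) \<and> total_gain H e l s \<le> ?F (idx u) + gain H u"
    then obtain u where "total_gain H e l s \<le> ?F (idx u) + gain H u" by blast
    then show ?thesis using cost[of "idx u"] gain_le[of u] by linarith
  qed
qed

text \<open>An opponent of cost at most \<open>D\<close> never lets a requirement
  \<open>e > D + B\<close> reach its target. Once everything relevant has settled, \<open>e\<close>
  is eligible at one of its stages after its final action, a contradiction.\<close>

lemma diagonal_not_obeys: "\<not> diagonal_set \<Turnstile>\<^sub>c seq_cost b"
proof
  assume "diagonal_set \<Turnstile>\<^sub>c seq_cost b"
  then obtain Bs where Bs: "computable_approx Bs diagonal_set"
    and sum: "summable (\<lambda>s. real_of_rat (stage_cost (seq_cost b) Bs (Suc s)))"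
    by (auto simp: obeys_def)
  have inc: "incseq b" using b by (simp add: left_ce_approx_def)
  obtain D :: nat where D: "(\<Sum>s. real_of_rat (stage_cost (seq_cost b) Bs (Suc s))) \<le> D"
    using real_arch_simple by blast
  have cost: "(\<Sum>t<n. stage_cost (seq_cost b) Bs (Suc t)) \<le> of_nat D" for n
  proof -
    have "(\<Sum>t<n. real_of_rat (stage_cost (seq_cost b) Bs (Suc t))) \<le> D"
      using sum_le_suminf[OF sum, of "{..<n}"] D stage_cost_nonneg[OF inc] by simp
    then have "real_of_rat (\<Sum>t<n. stage_cost (seq_cost b) Bs (Suc t)) \<le> real_of_rat (of_nat D)"
      by (simp add: of_rat_sum)
    then show ?thesis by (simp only: of_rat_less_eq)
  qed
  obtain p where p: "\<And>x. \<exists>s. sim p x s = Suc (set_encode (Bs x))"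
    using sim_universal[of "\<lambda>s. set_encode (Bs s)"] Bs
    by (auto simp: computable_approx_def computable_id_iff)
  \<comment> \<open>The second component ensures \<open>e > D + B\<close>, as a pair code is at
    least its second component.\<close>
  define e where "e = prod_encode (p, Suc (D + B))"
  have e: "pfst e = p" "D + B < e"
    using le_prod_encode_2[of "Suc (D + B)" p] by (simp_all add: e_def)
  have approx_Bs: "approx e s v = Bs v" if v: "v < halted e s" for s v
  proof -
    obtain s' where "sim p v s' = Suc (set_encode (Bs v))" using p by blast
    then have 1: "sim p v (max s s') = Suc (set_encode (Bs v))" by (rule sim_stable) simp
    have "sim p v s \<noteq> 0" using halted_sim[OF v] by (simp add: e)
    from sim_stable'[OF this, of "max s s'"] 1 have "sim p v s = Suc (set_encode (Bs v))" by simp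
    moreover have "finite (Bs v)" using Bs by (simp add: computable_approx_def)
    ultimately show ?thesis by (simp add: approx_def e)
  qed
  have halted_unbounded: "\<exists>s0. \<forall>s\<ge>s0. n < halted e s" for n
  proof -
    have "\<exists>s0. \<forall>s\<ge>s0. sim p t s \<noteq> 0" for t using p[of t] sim_stable by (metis nat.distinct(1))
    then obtain f where f: "\<And>t s. f t \<le> s \<Longrightarrow> sim p t s \<noteq> 0" by metis
    have "n < halted e s" if s: "max (Suc n) (Max (f ` {..n})) \<le> s" for s
    proof (rule ccontr)
      assume *: "\<not> n < halted e s"
      then have "f (halted e s) \<le> Max (f ` {..n})" by (intro Max_ge) auto
      also have "\<dots> \<le> s" using s by (rule max.boundedE)
      finally have "sim p (halted e s) s \<noteq> 0" by (rule f)
      moreover have "halted e s = s \<or> sim (pfst e) (halted e s) s = 0"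
        unfolding halted_def by (rule LeastI[of _ s]) simp
      ultimately show False using * s by (simp add: e)
    qed
    then show ?thesis by blast
  qed
  obtain l where l: "last_injury_at e l" using last_injury_at_exists by blast
  have small: "total_gain H e l s < of_nat e" if "l \<le> s" for s
  proof -
    have "total_gain H e l s \<le> of_nat (D + B)"
      using total_gain_le_cost[OF l approx_Bs cost that] by simp
    also have "\<dots> < of_nat e" using e(2) by (simp only: of_nat_less_iff)
    finally show ?thesis .
  qed
  \<comment> \<open>From stage \<open>w\<close> on, requirement \<open>e\<close> does not act any
    more.\<close>
  obtain w where w: "last_injury_at (Suc e) w" using last_injury_at_exists by blast
  obtain x T where x: "l \<le> x" "x < T" "b x < b T"
    "\<And>s t. T \<le> t \<Longrightarrow> of_nat (factor e l) * (a s - a x) < b t - b x"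
    using good_witness[OF l] by blast
  \<comment> \<open>After stage \<open>w\<close> this is the region on which eligibility asks for
    agreement.\<close>
  let ?M = "max (Suc x) w"
  have "\<forall>y\<in>{..<?M}. \<forall>\<^sub>F s in sequentially.
      (y \<in> Bs s \<longleftrightarrow> y \<in> diagonal_set) \<and> (member H s y \<longleftrightarrow> y \<in> diagonal_set)"
    using Bs eventually_member by (auto simp: computable_approx_def intro: eventually_conj)
  from eventually_ball_finite[OF _ this] obtain k where k:
    "\<And>s y. k \<le> s \<Longrightarrow> y < ?M \<Longrightarrow> (y \<in> Bs s \<longleftrightarrow> y \<in> diagonal_set) \<and> (member H s y \<longleftrightarrow> y \<in> diagonal_set)"
    by (auto simp: eventually_sequentially)
  obtain s0 where s0: "\<And>s. s0 \<le> s \<Longrightarrow> max k T < halted e s"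
    using halted_unbounded by blast
  \<comment> \<open>A stage reserved for \<open>e\<close> that lies beyond all the
    thresholds.\<close>
  define s where "s = prod_encode (e, s0 + l + w + k)"
  have se: "pfst s = e" by (simp add: s_def)
  have "s0 + l + w + k \<le> s" unfolding s_def by (rule le_prod_encode_2)
  then have s: "s0 \<le> s" "l \<le> s" "w \<le> s" "k \<le> s" by auto
  have t: "k \<le> halted e s - 1" "T \<le> halted e s - 1" "0 < halted e s" using s0[OF s(1)] by auto
  have "eligible H s x"
    using last_injury_atD(1)[OF l s(2)] last_injury_atD(1)[OF w s(3)] x(1,2) t small[OF s(2)] x(4)[OF t(2)] k[OF t(1)] k[OF s(4)]
    by (auto simp: eligible_def se Let_def approx_Bs)
  then have "H s \<noteq> 0" by (rule eligible_acts)
  then show False using last_injury_atD(2)[OF w s(3)] se by simp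
qed

end

lemma bounded_if_cost_implies:
  assumes a: "left_ce_approx a \<alpha>" and b: "left_ce_approx b \<beta>" and c: "seq_cost a \<rightarrow>\<^sub>c seq_cost b"
  shows "\<exists>N::nat. \<forall>x. \<beta> - real_of_rat (b x) \<le> N * (\<alpha> - real_of_rat (a x))"
proof (rule ccontr)
  assume *: "\<not> ?thesis"
  obtain B :: nat where B: "\<beta> \<le> B" using real_arch_simple by blast
  have nonneg: "0 \<le> b x" and below: "real_of_rat (a x) < \<alpha>" "real_of_rat (b x) < \<beta>" and inc: "incseq a" for x
    using a b by (auto simp: left_ce_approx_def)
  \<comment> \<open>A bound \<open>N\<close> valid from \<open>l\<close> on would extend to all
    \<open>x\<close>: below \<open>l\<close> the distance \<open>\<alpha> - a x\<close> is at least
    \<open>\<alpha> - a l\<close>, so some multiple \<open>M\<close> of it exceeds \<beta>, and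
    \<open>N + M\<close> is a bound everywhere.\<close>
  have "\<exists>x\<ge>l. N * (\<alpha> - real_of_rat (a x)) < \<beta> - real_of_rat (b x)" for N l :: nat
  proof (rule ccontr)
    assume l: "\<not> ?thesis"
    obtain M :: nat where "\<beta> / (\<alpha> - real_of_rat (a l)) \<le> M" using real_arch_simple by blast
    then have M: "\<beta> \<le> M * (\<alpha> - real_of_rat (a l))" using below(1)[of l] by (simp add: field_simps)
    have "\<beta> - real_of_rat (b x) \<le> (N + M) * (\<alpha> - real_of_rat (a x))" for x
    proof (cases "l \<le> x")
      case True
      then have "\<beta> - real_of_rat (b x) \<le> N * (\<alpha> - real_of_rat (a x))" using l by force
      moreover have "0 \<le> M * (\<alpha> - real_of_rat (a x))" using below(1)[of x] by simp
      ultimately show ?thesis by (simp add: algebra_simps)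
    next
      case False
      have "\<beta> - real_of_rat (b x) \<le> \<beta>" using nonneg[of x] by simp
      also note M
      also have "M * (\<alpha> - real_of_rat (a l)) \<le> M * (\<alpha> - real_of_rat (a x))"
        using False incseqD[OF inc, of x l] by (intro mult_left_mono) (auto simp: of_rat_less_eq)
      also have "\<dots> \<le> (N + M) * (\<alpha> - real_of_rat (a x))"
        using below(1)[of x] by (intro mult_right_mono) auto
      finally show ?thesis .
    qed
    then show False using * by blast
  qed
  \<comment> \<open>The successor makes the bound on \<beta> positive.\<close>
  then interpret unbounded_ratio a b \<alpha> \<beta> "Suc B"
    using a b B by unfold_locales auto
  obtain H where H: "total_rec H" "\<And>s. H s = action H s"
  proof (rule course_of_values_recursion[of action])
    show "total_rec (\<lambda>z. action (lookup (psnd z) (pfst z)) (pfst z))"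
      by (intro rec_intros)
  qed (blast intro: action_cong)+
  interpret diagonal a b \<alpha> \<beta> "Suc B" H
    using H by unfold_locales auto
  show False
    using c Delta02_diagonal diagonal_obeys diagonal_not_obeys by (auto simp: cost_implies_def)
qed

theorem proposition4p4:
  fixes \<alpha> \<beta> :: real
  assumes "left_ce \<alpha>" and "left_ce \<beta>"
    and "0 < \<alpha>" and "0 < \<beta>"
  shows "(\<beta> \<le>\<^sub>S \<alpha> \<longleftrightarrow>
           (\<forall>a. left_ce_approx a \<alpha> \<longrightarrow>
              (\<exists>b. left_ce_approx b \<beta> \<and> seq_cost a \<rightarrow>\<^sub>c seq_cost b))) \<and>
         (\<beta> \<le>\<^sub>S \<alpha> \<longleftrightarrow>
           (\<exists>a b. left_ce_approx a \<alpha> \<and> left_ce_approx b \<beta> \<and> seq_cost a \<rightarrow>\<^sub>c seq_cost b))"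
proof -
  have "\<exists>b. left_ce_approx b \<beta> \<and> seq_cost a \<rightarrow>\<^sub>c seq_cost b"
    if "\<beta> \<le>\<^sub>S \<alpha>" "left_ce_approx a \<alpha>" for a
    using solovay_le_imp_bounded[OF that] cost_implies_if_bounded[OF that(2)] by metis
  moreover have "\<beta> \<le>\<^sub>S \<alpha>"
    if "left_ce_approx a \<alpha>" "left_ce_approx b \<beta>" "seq_cost a \<rightarrow>\<^sub>c seq_cost b" for a b
    using bounded_if_cost_implies[OF that] solovay_le_if_bounded[OF that(1,2)] by blast
  \<comment> \<open>The universal statement yields the existential one once some approximation of
    \<alpha> is at hand.\<close>
  moreover have "\<exists>a. left_ce_approx a \<alpha>"
    using left_ce_approx_exists[OF assms(1,3)] .
  ultimately show ?thesis by metis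
qed

end
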